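(* Let $T$ be a Dunford--Schwartz operator on $(\Omega,\mathcal{A},\mathbb{P})$. Let $f\in\mathbb{L}^p$, $p>1$. Let $\psi$ be a positive nondecreasing function such that there exists $C>1$ with $\psi(2x)\le C\psi(x)$ for every $x\ge1$. Assume that $$\sum_{n}\frac{\|f+\cdots+T^{n-1}f\|_p}{\psi(n)\,n^{1+1/p}}<\infty .$$ Then $$\sup_{n\ge1}\frac{|f+\cdots+T^{n-1}f|}{\psi(n)\,n^{1/p}}\in\mathbb{L}^{p,w}\qquad\text{and}\qquad \frac{|f+\cdots+T^{n-1}f|}{\psi(n)\,n^{1/p}}\to0\quad\mathbb{P}\text{-a.s.}$$ Moreover, if $T$ is induced by a measure-preserving transformation, and $(\mathcal{B},|\cdot|_{\mathcal{B}})$ is a Banach space, the result holds with $|\cdot|_{\mathcal{B}}$ instead of $|\cdot|$ for every $f\in\mathbb{L}^p(\mathcal{B})$ such that $$\sum_n\frac{\bigl\|\,|f+\cdots+T^{n-1}f|_{\mathcal{B}}\,\bigr\|_p}{\psi(n)\,n^{1+1/p}}<\infty .$$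
   Context: $(\Omega,\mathcal{A},\mathbb{P})$ is a probability space. A Dunford--Schwartz operator $T$ is a linear operator that is a contraction of $\mathbb{L}^1$ and of $\mathbb{L}^\infty$ (hence acts on $\mathbb{L}^p$). $T$ is induced by a measurable transformation $\theta$ preserving $\mathbb{P}$ if $Tf=f\circ\theta$; it then acts also on $\mathcal{B}$-valued functions. $\mathbb{L}^p(\mathcal{B})$ is the Bochner space of ($\mathcal{B}$-valued, Bochner measurable) $f:\Omega\to\mathcal{B}$ with $|f|_{\mathcal{B}}\in\mathbb{L}^p$. $\mathbb{L}^{p,w}$ is the weak $\mathbb{L}^p$ space of measurable functions $g$ with $\sup_{\lambda>0}\lambda^p\,\mathbb{P}\{|g|\ge\lambda\}<\infty$. $\|\cdot\|_p$ is the $\mathbb{L}^p$ norm. *)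

theory Defs
  imports "HOL-Probability.Essential_Supremum" "HOL-Probability.Probability_Measure"
begin

section \<open>Bochner measurability and the spaces \<open>L\<^sup>p(B)\<close>\<close>

text \<open>In a nonseparable Banach space Borel measurability is too weak, and the library's
  Bochner integral is restricted to second countable spaces.\<close>

definition bochner_measurable :: "'a measure \<Rightarrow> ('a \<Rightarrow> 'b::banach) \<Rightarrow> bool" where
  "bochner_measurable M f \<longleftrightarrow>
     (\<exists>s. (\<forall>i. simple_function M (s i)) \<and> (\<forall>\<omega>\<in>space M. (\<lambda>i. s i \<omega>) \<longlonglongrightarrow> f \<omega>))"

definition Lp_norm :: "'a measure \<Rightarrow> real \<Rightarrow> ('a \<Rightarrow> 'b::banach) \<Rightarrow> ennreal" where
  "Lp_norm M p f =
     (let I = (\<integral>\<^sup>+ \<omega>. ennreal (norm (f \<omega>) powr p) \<partial>M)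
      in if I = \<infinity> then \<infinity> else ennreal (enn2real I powr (1 / p)))"

definition Lp_space :: "'a measure \<Rightarrow> real \<Rightarrow> ('a \<Rightarrow> 'b::banach) set" where
  "Lp_space M p = {f. bochner_measurable M f \<and> Lp_norm M p f < \<infinity>}"

text \<open>Weak \<open>L\<^sup>p\<close> for functions with values in \<open>[0, \<infinity>]\<close>, such as suprema of norms. Finiteness of
  the supremum below forces the function to be finite almost everywhere.\<close>

definition weak_Lp :: "'a measure \<Rightarrow> real \<Rightarrow> ('a \<Rightarrow> ennreal) set" where
  "weak_Lp M p = {g \<in> borel_measurable M.
     (SUP t\<in>{0<..}. ennreal (t powr p) * emeasure M {\<omega>\<in>space M. ennreal t \<le> g \<omega>}) < \<infinity>}"


section \<open>Dunford--Schwartz operators\<close>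

text \<open>An operator on \<open>L\<^sup>1\<close> is represented by a map on functions, of which only the values at
  integrable functions matter and whose algebraic laws hold up to null sets. Complete normed fields
  with multiplicative norm are exactly the reals and the complex numbers, so the type variable for
  scalars covers the real and the complex case. The essential supremum in the last clause is
  \<open>\<infinity>\<close> unless \<open>f\<close> belongs to \<open>L\<^sup>\<infinity>\<close>.\<close>

definition dunford_schwartz ::
  "'a measure \<Rightarrow> (('a \<Rightarrow> 'k) \<Rightarrow> ('a \<Rightarrow> 'k::{real_normed_field, banach, second_countable_topology})) \<Rightarrow> bool"
  where
  "dunford_schwartz M T \<longleftrightarrow>
     (\<forall>f. integrable M f \<longrightarrow> integrable M (T f)) \<and>
     (\<forall>f g. integrable M f \<longrightarrow> integrable M g \<longrightarrow> (AE \<omega> in M. f \<omega> = g \<omega>) \<longrightarrow>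
        (AE \<omega> in M. T f \<omega> = T g \<omega>)) \<and>
     (\<forall>f g. integrable M f \<longrightarrow> integrable M g \<longrightarrow>
        (AE \<omega> in M. T (\<lambda>x. f x + g x) \<omega> = T f \<omega> + T g \<omega>)) \<and>
     (\<forall>c f. integrable M f \<longrightarrow> (AE \<omega> in M. T (\<lambda>x. c * f x) \<omega> = c * T f \<omega>)) \<and>
     (\<forall>f. integrable M f \<longrightarrow> (LINT \<omega>|M. norm (T f \<omega>)) \<le> (LINT \<omega>|M. norm (f \<omega>))) \<and>
     (\<forall>f. integrable M f \<longrightarrow>
        esssup M (\<lambda>\<omega>. ennreal (norm (T f \<omega>))) \<le> esssup M (\<lambda>\<omega>. ennreal (norm (f \<omega>))))"

definition measure_preserving_map :: "'a measure \<Rightarrow> ('a \<Rightarrow> 'a) \<Rightarrow> bool" where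
  "measure_preserving_map M \<theta> \<longleftrightarrow> \<theta> \<in> measurable M M \<and> distr M M \<theta> = M"

definition induced_by ::
  "'a measure \<Rightarrow> (('a \<Rightarrow> 'k) \<Rightarrow> ('a \<Rightarrow> 'k::{real_normed_field, banach, second_countable_topology}))
     \<Rightarrow> ('a \<Rightarrow> 'a) \<Rightarrow> bool" where
  "induced_by M T \<theta> \<longleftrightarrow> measure_preserving_map M \<theta> \<and>
     (\<forall>f. integrable M f \<longrightarrow> (AE \<omega> in M. T f \<omega> = f (\<theta> \<omega>)))"

definition ergodic_sum :: "(('a \<Rightarrow> 'b) \<Rightarrow> ('a \<Rightarrow> 'b::banach)) \<Rightarrow> ('a \<Rightarrow> 'b) \<Rightarrow> nat \<Rightarrow> 'a \<Rightarrow> 'b" where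
  "ergodic_sum T f n \<omega> = (\<Sum>k<n. (T ^^ k) f \<omega>)"


section \<open>Consistency with the library for separable targets\<close>

lemma bochner_measurable_iff_borel:
  fixes f :: "'a \<Rightarrow> 'b::{banach, second_countable_topology}"
  shows "bochner_measurable M f \<longleftrightarrow> f \<in> borel_measurable M"
proof
  assume "bochner_measurable M f"
  then obtain s where s: "\<And>i. simple_function M (s i)"
    "\<And>\<omega>. \<omega> \<in> space M \<Longrightarrow> (\<lambda>i. s i \<omega>) \<longlonglongrightarrow> f \<omega>"
    unfolding bochner_measurable_def by blast
  from s(1) have "s i \<in> borel_measurable M" for i
    by (rule borel_measurable_simple_function)
  then show "f \<in> borel_measurable M"
    using s(2) by (rule borel_measurable_LIMSEQ_metric)
next
  assume "f \<in> borel_measurable M"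
  from borel_measurable_implies_sequence_metric[OF this, of 0]
  show "bochner_measurable M f"
    unfolding bochner_measurable_def by blast
qed

lemma Lp_space_1_iff_integrable:
  fixes f :: "'a \<Rightarrow> 'b::{banach, second_countable_topology}"
  shows "f \<in> Lp_space M 1 \<longleftrightarrow> integrable M f"
proof -
  have "f \<in> Lp_space M 1 \<longleftrightarrow> f \<in> borel_measurable M \<and> (\<integral>\<^sup>+ \<omega>. ennreal (norm (f \<omega>)) \<partial>M) \<noteq> \<infinity>"
    by (simp add: Lp_space_def Lp_norm_def Let_def bochner_measurable_iff_borel)
  then show ?thesis
    by (simp add: integrable_iff_bounded less_top)
qed

end

theory Submission
  imports Defs
begin

text \<open>
  Write \<open>S\<^sub>n\<close> for the partial sums of \<open>X\<^sub>k = T\<^sup>k f\<close>. Truncation at height \<open>c\<close> shows that \<open>T\<close>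
  decreases the excesses \<open>E(\<bar>g\<bar> - c)\<^sup>+\<close>, and this is the only property of the operator that is
  needed. Decomposing \<open>n\<close> in binary, \<open>\<bar>S\<^sub>n\<bar> / (\<psi>(n) n powr (1 / p))\<close> is at most
  \<open>\<Sum>j. c\<^sub>j Y\<^sub>j\<^sub>,\<^sub>m\<close>, where \<open>c\<^sub>j = 1 / (\<psi>(2 ^ j) 2 powr (j / p))\<close>, \<open>Y\<^sub>j\<^sub>,\<^sub>m\<close> is the norm of a sum over
  \<open>[m 2 ^ j, (m + 1) 2 ^ j)\<close> divided by \<open>(m + 1) powr (1 / p)\<close>, and \<open>m\<close> is a function of \<open>n\<close> and \<open>j\<close>
  that tends to infinity with \<open>n\<close>. By quasi-subadditivity of \<open>\<parallel>S\<^sub>n\<parallel>\<^sub>p\<close> the hypothesis says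
  \<open>\<Sum>j. c\<^sub>j A\<^sub>j < \<infinity>\<close> with \<open>A\<^sub>j = \<parallel>S\<^sub>2\<^sub>^\<^sub>j\<parallel>\<^sub>p\<close>. As \<open>p > 1\<close>, the total excess
  \<open>\<Sum>j. c\<^sub>j (\<Sum>m. (Y\<^sub>j\<^sub>,\<^sub>m - s A\<^sub>j)\<^sup>+)\<close> has expectation at most a constant times
  \<open>s powr (1 - p) * (\<Sum>j. c\<^sub>j A\<^sub>j)\<close>. Taking \<open>s\<close> proportional to the level and applying Markov's
  inequality gives the weak type bound. Almost sure finiteness for all \<open>s\<close> makes \<open>Y\<^sub>j\<^sub>,\<^sub>m\<close> tend to
  \<open>0\<close> as \<open>m\<close> grows, with a summable majorant in \<open>j\<close>, whence convergence.
\<close>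

section \<open>Elementary estimates\<close>

text \<open>Comparison with the integral of \<open>z powr (- a)\<close>: by the mean value theorem,
  \<open>1 - a\<close> times a summand is at most the corresponding increment of
  \<open>N powr (1 - a)\<close>.\<close>

lemma sum_powr_neg_le:
  fixes a :: real
  assumes "0 < a" "a < 1"
  shows "(\<Sum>m<N. real (Suc m) powr (- a)) \<le> real N powr (1 - a) / (1 - a)"
proof (induction N)
  case 0
  then show ?case by simp
next
  case (Suc N)
  have "(1 - a) * real (Suc N) powr (- a) \<le> real (Suc N) powr (1 - a) - real N powr (1 - a)"
  \<comment> \<open>The power is not differentiable at \<open>0\<close>, so the first increment is
    computed directly.\<close>
  proof (cases "N = 0")
    case True
    then show ?thesis using assms by simp
  next
    case False
    have "\<exists>z::real. real N < z \<and> z < real (Suc N) \<and>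
        real (Suc N) powr (1 - a) - real N powr (1 - a) = (real (Suc N) - real N) * ((1 - a) * z powr (- a))"
    proof (rule MVT2)
      show "real N < real (Suc N)" by simp
      fix x :: real assume x: "real N \<le> x" "x \<le> real (Suc N)"
      then have "x > 0" using False by linarith
      then show "((\<lambda>z. z powr (1 - a)) has_real_derivative (1 - a) * x powr (- a)) (at x)"
        by (auto intro!: derivative_eq_intros)
    qed
    then obtain z where z: "real N < z" "z < real (Suc N)"
      "real (Suc N) powr (1 - a) - real N powr (1 - a) = (1 - a) * z powr (- a)"
      by auto
    have "real (Suc N) powr (- a) \<le> z powr (- a)"
      using z False assms by (intro powr_mono2') auto
    then show ?thesis using z(3) assms by simp
  qed
  then have "real (Suc N) powr (- a) \<le> (real (Suc N) powr (1 - a) - real N powr (1 - a)) / (1 - a)"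
    using assms by (simp add: field_simps)
  with Suc.IH show ?case by (simp add: diff_divide_distrib)
qed

text \<open>Up to constants this is \<open>\<tau> powr (1 - p) * x powr p\<close> once \<open>x \<ge> 2 * \<tau>\<close>, so that controlling excesses controls
  \<open>p\<close>-th moments.\<close>

definition tail_series :: "real \<Rightarrow> real \<Rightarrow> real \<Rightarrow> ennreal" where
  "tail_series p \<tau> x =
     (\<Sum>m. ennreal (real (Suc m) powr (- (1 / p))) * ennreal (x - \<tau> * real (Suc m) powr (1 / p)))"

lemma measurable_tail_series [measurable]: "tail_series p \<tau> \<in> borel_measurable borel"
  unfolding tail_series_def [abs_def] by measurable

text \<open>With \<open>R = (x / \<tau>) powr p\<close>, only terms with
  \<open>Suc m \<le> R\<close> can be nonzero. Dropping their thresholds leaves at most a constant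
  times \<open>x * R powr (1 - 1 / p)\<close>.\<close>

lemma tail_series_le:
  assumes p: "1 < p" and \<tau>: "0 < \<tau>" and x: "0 \<le> x"
  shows "tail_series p \<tau> x \<le> ennreal (p / (p - 1) * \<tau> powr (1 - p) * x powr p)"
proof -
  define R where "R = (x / \<tau>) powr p"
  have a: "0 < 1 / p" "1 / p < 1" "1 - 1 / p > 0" using p by auto
  define t where "t m = ennreal (real (Suc m) powr (- (1 / p))) * ennreal (x - \<tau> * real (Suc m) powr (1 / p))" for m
  define L where "L = nat \<lfloor>R\<rfloor>"
  have R0: "R \<ge> 0" by (simp add: R_def)
  have L: "real L \<le> R" using R0 by (simp add: L_def)
  have t_zero: "t m = 0" if "m \<notin> {..<L}" for m
  proof -
    have "R < real (Suc m)" using that R0 unfolding L_def by simp linarith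
    then have "R powr (1 / p) \<le> real (Suc m) powr (1 / p)"
      using R0 p by (intro powr_mono2) auto
    moreover have "R powr (1 / p) = x / \<tau>" using p \<tau> x by (simp add: R_def powr_powr)
    ultimately have "x - \<tau> * real (Suc m) powr (1 / p) \<le> 0" using \<tau> by (simp add: field_simps)
    then show ?thesis by (simp add: t_def ennreal_neg)
  qed
  have "tail_series p \<tau> x = (\<Sum>m<L. t m)"
    unfolding tail_series_def t_def[symmetric]
    by (rule suminf_finite) (use t_zero in auto)
  also have "\<dots> \<le> (\<Sum>m<L. ennreal (x * real (Suc m) powr (- (1 / p))))"
  proof (rule sum_mono)
    fix m
    have "ennreal (x - \<tau> * real (Suc m) powr (1 / p)) \<le> ennreal x"
      using \<tau> by (intro ennreal_leI) simp
    then have "t m \<le> ennreal (real (Suc m) powr (- (1 / p))) * ennreal x"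
      unfolding t_def by (rule mult_left_mono) simp
    then show "t m \<le> ennreal (x * real (Suc m) powr (- (1 / p)))"
      by (simp add: ennreal_mult' x mult.commute del: of_nat_Suc)
  qed
  also have "\<dots> = ennreal (x * (\<Sum>m<L. real (Suc m) powr (- (1 / p))))"
    using x by (simp add: sum_ennreal sum_distrib_left del: of_nat_Suc)
  also have "\<dots> \<le> ennreal (p / (p - 1) * \<tau> powr (1 - p) * x powr p)"
  proof (rule ennreal_leI)
    have "(\<Sum>m<L. real (Suc m) powr (- (1 / p))) \<le> real L powr (1 - 1 / p) / (1 - 1 / p)"
      using sum_powr_neg_le[OF a(1,2)] .
    also have "\<dots> \<le> R powr (1 - 1 / p) / (1 - 1 / p)"
      using L a by (intro divide_right_mono powr_mono2) auto
    also have "R powr (1 - 1 / p) = (x / \<tau>) powr (p - 1)"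
      using p by (simp add: R_def powr_powr right_diff_distrib)
    also have "(x / \<tau>) powr (p - 1) / (1 - 1 / p) = p / (p - 1) * (x / \<tau>) powr (p - 1)"
      using p by (simp add: field_simps)
    finally have "x * (\<Sum>m<L. real (Suc m) powr (- (1 / p))) \<le> x * (p / (p - 1) * (x / \<tau>) powr (p - 1))"
      using x by (rule mult_left_mono)
    also have "\<dots> = p / (p - 1) * \<tau> powr (1 - p) * x powr p"
    proof (cases "x = 0")
      case False
      then have "(x / \<tau>) powr (p - 1) = x powr p / x * \<tau> powr (1 - p)"
        using x \<tau> by (simp add: powr_divide powr_diff field_simps)
      then show ?thesis using False by simp
    qed simp
    finally show "x * (\<Sum>m<L. real (Suc m) powr (- (1 / p))) \<le> p / (p - 1) * \<tau> powr (1 - p) * x powr p" .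
  qed
  finally show ?thesis .
qed

text \<open>For \<open>Suc m \<le> (x / (2 * \<tau>)) powr p\<close> the threshold is at most
  \<open>x / 2\<close>, so half of \<open>x\<close> survives in each of these terms; the remaining
  terms are discarded.\<close>

lemma tail_series_ge:
  assumes p: "1 < p" and \<tau>: "0 < \<tau>" and x: "2 * \<tau> \<le> x"
  shows "ennreal (x powr p) \<le> ennreal (2 powr (p + 1) * \<tau> powr (p - 1)) * tail_series p \<tau> x"
proof -
  define R where "R = (x / (2 * \<tau>)) powr p"
  have x0: "x > 0" using x \<tau> by linarith
  define L where "L = nat \<lfloor>R\<rfloor>"
  have R1: "R \<ge> 1" using x \<tau> p by (simp add: R_def ge_one_powr_ge_zero)
  \<comment> \<open>Rounding down a number that is at least \<open>1\<close> loses at most half of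
    it; this is where \<open>2 * \<tau> \<le> x\<close> enters.\<close>
  have "\<lfloor>R\<rfloor> \<ge> 1" using R1 by simp
  then have "real L = of_int \<lfloor>R\<rfloor>" "real_of_int \<lfloor>R\<rfloor> \<ge> 1" by (simp_all add: L_def)
  then have L: "real L \<le> R" "real L \<ge> R / 2" "real L \<ge> 1" by linarith+
  define t where "t m = ennreal (real (Suc m) powr (- (1 / p))) * ennreal (x - \<tau> * real (Suc m) powr (1 / p))" for m
  have Rp: "R powr (1 / p) = x / (2 * \<tau>)" using p \<tau> x0 by (simp add: R_def powr_powr)
  have t_ge: "ennreal (real L powr (- (1 / p)) * (x / 2)) \<le> t m" if "m < L" for m
  proof -
    have m: "real (Suc m) \<le> real L" using that by linarith
    have "real (Suc m) powr (1 / p) \<le> R powr (1 / p)"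
      using m L p by (intro powr_mono2) auto
    then have "\<tau> * real (Suc m) powr (1 / p) \<le> x / 2" unfolding Rp using \<tau> by (simp add: field_simps)
    then have "x / 2 \<le> x - \<tau> * real (Suc m) powr (1 / p)" by linarith
    moreover have "real L powr (- (1 / p)) \<le> real (Suc m) powr (- (1 / p))"
      using m p by (intro powr_mono2') auto
    ultimately show ?thesis
      unfolding t_def using x0 by (subst ennreal_mult) (auto intro!: mult_mono ennreal_leI simp del: of_nat_Suc)
  qed
  have "R powr (1 - 1 / p) / 2 = R / 2 * R powr (- (1 / p))"
    using R1 by (simp add: powr_diff powr_minus field_simps)
  also have "\<dots> \<le> real L * real L powr (- (1 / p))"
    using L R1 p by (intro mult_mono powr_mono2') auto
  finally have A: "R powr (1 - 1 / p) / 2 \<le> real L * real L powr (- (1 / p))" .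
  have "R powr (1 - 1 / p) = (x / (2 * \<tau>)) powr (p - 1)"
    using p by (simp add: R_def powr_powr right_diff_distrib)
  also have "\<dots> = x powr p / x * 2 powr (1 - p) * \<tau> powr (1 - p)"
    using x0 \<tau> by (simp add: powr_divide powr_mult powr_diff field_simps)
  finally have B: "R powr (1 - 1 / p) = x powr p / x * 2 powr (1 - p) * \<tau> powr (1 - p)" .
  have "x powr p = 2 powr (p + 1) * \<tau> powr (p - 1) * (R powr (1 - 1 / p) / 2 * (x / 2))"
    unfolding B using x0 \<tau> by (simp add: powr_diff powr_add field_simps)
  also have "\<dots> \<le> 2 powr (p + 1) * \<tau> powr (p - 1) * (real L * real L powr (- (1 / p)) * (x / 2))"
    using A x0 by (intro mult_left_mono mult_right_mono) auto
  finally have "ennreal (x powr p) \<le>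
      ennreal (2 powr (p + 1) * \<tau> powr (p - 1)) * ennreal (real L * real L powr (- (1 / p)) * (x / 2))"
    by (subst ennreal_mult[symmetric]) (use x0 in \<open>auto intro!: ennreal_leI\<close>)
  also have "ennreal (real L * real L powr (- (1 / p)) * (x / 2)) = (\<Sum>m<L. ennreal (real L powr (- (1 / p)) * (x / 2)))"
    using x0 by (simp add: ennreal_of_nat_eq_real_of_nat ennreal_mult[symmetric] mult.assoc)
  also have "\<dots> \<le> (\<Sum>m<L. t m)" by (intro sum_mono t_ge) auto
  also have "\<dots> \<le> (\<Sum>m. t m)" by (rule sum_le_suminf) auto
  also have "\<dots> = tail_series p \<tau> x" by (simp add: tail_series_def t_def)
  finally show ?thesis by (simp add: mult_left_mono)
qed

section \<open>Binary decomposition of partial sums and dyadic subsequences\<close>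

text \<open>Round \<open>k\<close> down to multiples of \<open>2 ^ i\<close>. Refining from
  \<open>2 ^ Suc i\<close> to \<open>2 ^ i\<close> adds one block of length \<open>2 ^ i\<close>
  exactly when the \<open>i\<close>-th binary digit of \<open>k\<close> is one, that is, when
  \<open>k div 2 ^ i\<close> is odd.\<close>

lemma norm_sum_binary_blocks:
  fixes x :: "nat \<Rightarrow> 'b::real_normed_vector"
  shows "norm (\<Sum>j<k. x j) \<le>
    (\<Sum>i<k. if odd (k div 2 ^ i)
      then norm (\<Sum>j\<in>{(k div 2 ^ i - 1) * 2 ^ i..<(k div 2 ^ i - 1) * 2 ^ i + 2 ^ i}. x j) else 0)"
proof -
  define d where "d i = (if odd (k div 2 ^ i)
      then norm (\<Sum>j\<in>{(k div 2 ^ i - 1) * 2 ^ i..<(k div 2 ^ i - 1) * 2 ^ i + 2 ^ i}. x j) else 0)" for i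
  have step: "norm (\<Sum>j<k div 2 ^ i * 2 ^ i. x j) \<le> norm (\<Sum>j<k div 2 ^ Suc i * 2 ^ Suc i. x j) + d i" for i
  proof -
    have h: "k div 2 ^ Suc i = k div 2 ^ i div 2" by (metis div_mult2_eq power_Suc2)
    show ?thesis
    proof (cases "odd (k div 2 ^ i)")
      case True
      then obtain a where a: "k div 2 ^ i = 2 * a + 1" by (rule oddE)
      define q where "q = (k div 2 ^ i - 1) * 2 ^ i"
      have e: "k div 2 ^ Suc i * 2 ^ Suc i = q" "k div 2 ^ i * 2 ^ i = q + 2 ^ i"
        unfolding h q_def a by (simp_all add: algebra_simps)
      have "(\<Sum>j<q + 2 ^ i. x j) = (\<Sum>j<q. x j) + (\<Sum>j\<in>{q..<q + 2 ^ i}. x j)"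
        by (subst sum.union_disjoint[symmetric]) (auto intro!: sum.cong)
      then show ?thesis unfolding e d_def q_def[symmetric] using True by (simp add: norm_triangle_ineq)
    next
      case False
      then have "2 dvd k div 2 ^ i" by simp
      then obtain a where a: "k div 2 ^ i = 2 * a" by (rule dvdE)
      have e: "k div 2 ^ Suc i * 2 ^ Suc i = k div 2 ^ i * 2 ^ i"
        unfolding h a by simp
      have "d i = 0" using False by (simp add: d_def)
      then show ?thesis unfolding e by simp
    qed
  qed
  have "norm (\<Sum>j<k. x j) \<le> norm (\<Sum>j<k div 2 ^ n * 2 ^ n. x j) + (\<Sum>i<n. d i)" for n
  proof (induction n)
    case (Suc n)
    then show ?case using step[of n] by simp
  qed simp
  \<comment> \<open>As \<open>k < 2 ^ k\<close>, rounding down to a multiple of \<open>2 ^ k\<close>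
    leaves the empty sum.\<close>
  from this[of k] show ?thesis by (simp add: d_def)
qed

lemma summable_dyadic_blocks:
  fixes b :: "nat \<Rightarrow> real"
  assumes b: "\<And>n. 0 \<le> b n" and sm: "summable b"
  shows "summable (\<lambda>j. \<Sum>n\<in>{2 ^ j..<2 ^ Suc j}. b n)"
proof (rule summableI_nonneg_bounded)
  show "0 \<le> (\<Sum>n\<in>{2 ^ j..<2 ^ Suc j}. b n)" for j by (intro sum_nonneg b)
  fix J
  have "(\<Sum>j<J. \<Sum>n\<in>{2 ^ j..<2 ^ Suc j}. b n) = (\<Sum>n\<in>{1..<2 ^ J}. b n)"
  proof (induction J)
    case (Suc J)
    have "(\<Sum>n\<in>{1..<2 ^ J}. b n) + (\<Sum>n\<in>{2 ^ J..<2 ^ Suc J}. b n) = (\<Sum>n\<in>{1..<2 ^ Suc J}. b n)"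
      by (rule sum.atLeastLessThan_concat) auto
    with Suc show ?case by simp
  qed simp
  also have "\<dots> \<le> suminf b" by (rule sum_le_suminf[OF sm]) (use b in auto)
  finally show "(\<Sum>j<J. \<Sum>n\<in>{2 ^ j..<2 ^ Suc j}. b n) \<le> suminf b" .
qed

text \<open>Since \<open>a\<close> need not be monotone, \<open>a (2 ^ j)\<close> is compared
  through \<open>quasi\<close> with \<open>a n\<close> and \<open>a (n + 2 ^ j)\<close> for every
  \<open>n\<close> of the dyadic block, and then averaged over these \<open>n\<close>.\<close>

lemma summable_dyadic_subsequence:
  fixes a :: "nat \<Rightarrow> real" and \<psi> :: "real \<Rightarrow> real" and p C \<kappa> :: real
  assumes a0: "\<And>n. 0 \<le> a n" and \<kappa>: "0 \<le> \<kappa>"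
    and quasi: "\<And>n N. 0 < n \<Longrightarrow> a N \<le> \<kappa> * (a (n + N) + a n)"
    and p: "1 < p"
    and pos: "\<And>x. x \<ge> 1 \<Longrightarrow> \<psi> x > 0"
    and mono: "mono_on {1..} \<psi>"
    and C: "C > 1"
    and dbl: "\<And>x. x \<ge> 1 \<Longrightarrow> \<psi> (2 * x) \<le> C * \<psi> x"
    and sm: "summable (\<lambda>n. a (Suc n) / (\<psi> (real (Suc n)) * real (Suc n) powr (1 + 1 / p)))"
  shows "summable (\<lambda>j. a (2 ^ j) / (\<psi> (2 ^ j) * (2 ^ j) powr (1 / p)))"
proof -
  define b where "b n = (if n = 0 then 0 else a n / (\<psi> (real n) * real n powr (1 + 1 / p)))" for n :: nat
  define B where "B j = (\<Sum>n\<in>{2 ^ j..<2 ^ Suc j}. b n)" for j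
  define W where "W j = \<psi> (2 ^ j) * (2 ^ j) powr (1 / p)" for j :: nat
  \<comment> \<open>The indices that occur are at most \<open>4 * 2 ^ j\<close>: two doublings of
    \<open>\<psi>\<close> cost \<open>C\<^sup>2\<close>, and the power of the index costs the other
    factor.\<close>
  define D where "D = C\<^sup>2 * 4 powr (1 + 1 / p)"
  have D0: "D \<ge> 0" using C by (simp add: D_def)
  have b0: "0 \<le> b n" for n 
  proof (cases "n = 0")
    case False
    then have "\<psi> (real n) > 0" using pos[of "real n"] by simp
    then show ?thesis using a0[of n] by (simp add: b_def)
  qed (simp add: b_def)
  have "summable (\<lambda>n. b (Suc n))" using sm by (simp add: b_def)
  then have "summable b" by (subst (asm) summable_Suc_iff)
  then have smB: "summable B" unfolding B_def by (intro summable_dyadic_blocks b0)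
  have W0: "W j > 0" for j using pos[of "2 ^ j"] by (simp add: W_def)
  have a_le: "a k \<le> D * 2 ^ j * W j * b k" if k: "0 < k" "k \<le> 4 * 2 ^ j" for k j
  proof -
    have k': "1 \<le> real k" "real k \<le> 4 * 2 ^ j" using k by (simp, metis of_nat_le_iff of_nat_mult of_nat_numeral of_nat_power)
    have "\<psi> (real k) \<le> \<psi> (4 * 2 ^ j)" using k' by (intro mono_onD[OF mono]) auto
    also have "\<dots> = \<psi> (2 * (2 * 2 ^ j))" by simp
    also have "\<dots> \<le> C * \<psi> (2 * 2 ^ j)"
      using one_le_power[of "2::real" "Suc j"] by (intro dbl) simp
    also have "\<dots> \<le> C * (C * \<psi> (2 ^ j))" using C dbl[of "2 ^ j"] by (intro mult_left_mono) auto
    finally have 1: "\<psi> (real k) \<le> C\<^sup>2 * \<psi> (2 ^ j)" by (simp add: power2_eq_square)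
    have "real k powr (1 + 1 / p) \<le> (4 * 2 ^ j) powr (1 + 1 / p)"
      using k' p by (intro powr_mono2) auto
    also have "\<dots> = 4 powr (1 + 1 / p) * 2 ^ j * (2 ^ j) powr (1 / p)"
      by (simp add: powr_mult powr_add)
    finally have 2: "real k powr (1 + 1 / p) \<le> 4 powr (1 + 1 / p) * 2 ^ j * (2 ^ j) powr (1 / p)" .
    have "\<psi> (real k) * real k powr (1 + 1 / p) \<le> (C\<^sup>2 * \<psi> (2 ^ j)) * (4 powr (1 + 1 / p) * 2 ^ j * (2 ^ j) powr (1 / p))"
      using pos[of "2 ^ j"] C by (intro mult_mono 1 2) auto
    also have "\<dots> = D * 2 ^ j * W j" by (simp add: D_def W_def)
    finally have 3: "\<psi> (real k) * real k powr (1 + 1 / p) \<le> D * 2 ^ j * W j" .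
    have "a k = \<psi> (real k) * real k powr (1 + 1 / p) * b k"
      using pos[of "real k"] k' by (simp add: b_def)
    also have "\<dots> \<le> D * 2 ^ j * W j * b k" using 3 b0 by (rule mult_right_mono)
    finally show ?thesis .
  qed
  have main: "a (2 ^ j) / W j \<le> \<kappa> * D * (B j + B (Suc j))" for j
  proof -
    have pt: "a (2 ^ j) / W j \<le> \<kappa> * D * 2 ^ j * (b n + b (n + 2 ^ j))" if n: "n \<in> {2 ^ j..<2 ^ Suc j}" for n
    proof -
      have n0: "0 < n" using n by (auto intro: less_le_trans[of 0 "2 ^ j"])
      \<comment> \<open>Both \<open>n\<close> and \<open>n + 2 ^ j\<close> stay in the dyadic blocks \<open>j\<close> and \<open>j + 1\<close>, so each index is used
        boundedly often.\<close>
      have "a (2 ^ j) \<le> \<kappa> * (a (n + 2 ^ j) + a n)" by (rule quasi[OF n0])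
      also have "\<dots> \<le> \<kappa> * (D * 2 ^ j * W j * b (n + 2 ^ j) + D * 2 ^ j * W j * b n)"
        using n n0 by (intro mult_left_mono \<kappa> add_mono a_le) auto
      also have "\<dots> = \<kappa> * D * 2 ^ j * (b n + b (n + 2 ^ j)) * W j" by (simp add: algebra_simps)
      finally show ?thesis using W0[of j] by (simp add: pos_divide_le_eq)
    qed
    \<comment> \<open>The block has \<open>2 ^ j\<close> members, which offsets the factor
      \<open>2 ^ j\<close> by which the weights in the full series exceed
      \<open>W j\<close>.\<close>
    have "2 ^ j * (a (2 ^ j) / W j) = (\<Sum>n\<in>{2 ^ j..<2 ^ Suc j :: nat}. a (2 ^ j) / W j)" by simp
    also have "\<dots> \<le> (\<Sum>n\<in>{2 ^ j..<2 ^ Suc j}. \<kappa> * D * 2 ^ j * (b n + b (n + 2 ^ j)))"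
      by (rule sum_mono) (rule pt)
    also have "\<dots> = \<kappa> * D * 2 ^ j * (B j + (\<Sum>n\<in>{2 ^ j..<2 ^ Suc j}. b (n + 2 ^ j)))"
      by (simp add: sum_distrib_left[symmetric] sum.distrib B_def)
    also have "(\<Sum>n\<in>{2 ^ j..<2 ^ Suc j}. b (n + 2 ^ j)) = (\<Sum>n\<in>{2 ^ j + 2 ^ j..<2 ^ Suc j + 2 ^ j}. b n)"
      by (rule sum.shift_bounds_nat_ivl[symmetric])
    also have "\<kappa> * D * 2 ^ j * (B j + \<dots>) \<le> \<kappa> * D * 2 ^ j * (B j + B (Suc j))"
      unfolding B_def using \<kappa> D0 by (intro mult_left_mono add_left_mono sum_mono2) (auto intro: b0)
    finally have "2 ^ j * (a (2 ^ j) / W j) \<le> 2 ^ j * (\<kappa> * D * (B j + B (Suc j)))"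
      by (simp only: mult_ac)
    then show ?thesis by (rule mult_left_le_imp_le) simp
  qed
  have "summable (\<lambda>j. \<kappa> * D * (B j + B (Suc j)))"
    using smB by (intro summable_mult summable_add) (simp_all add: summable_Suc_iff)
  then have "summable (\<lambda>j. a (2 ^ j) / W j)"
    by (rule summable_comparison_test') (use main a0 W0 in \<open>simp add: less_imp_le abs_of_nonneg\<close>)
  then show ?thesis by (simp add: W_def)
qed

text \<open>Because \<open>2 ^ i * (k div 2 ^ i) \<le> k\<close> and \<open>\<psi>\<close> is
  nondecreasing, the normalisation at \<open>k\<close> is at least the one at \<open>2 ^ i\<close>
  times \<open>(k div 2 ^ i) powr (1 / p)\<close>. Each binary block can thus be given its own
  normalisation.\<close>

lemma weighted_norm_sum_le:
  fixes x :: "nat \<Rightarrow> 'b::real_normed_vector" and \<psi> :: "real \<Rightarrow> real"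
  assumes p: "0 < p" and pos: "\<And>t. t \<ge> 1 \<Longrightarrow> \<psi> t > 0" and mono: "mono_on {1..} \<psi>"
  shows "norm (\<Sum>j<k. x j) / (\<psi> (real k) * real k powr (1 / p)) \<le>
    (\<Sum>i<k. if odd (k div 2 ^ i) then 1 / (\<psi> (2 ^ i) * (2 ^ i) powr (1 / p)) *
       (norm (\<Sum>j\<in>{(k div 2 ^ i - 1) * 2 ^ i..<(k div 2 ^ i - 1) * 2 ^ i + 2 ^ i}. x j) *
         real (Suc (k div 2 ^ i - 1)) powr (- (1 / p))) else 0)"
proof (cases "k = 0")
  case False
  define v where "v i = norm (\<Sum>j\<in>{(k div 2 ^ i - 1) * 2 ^ i..<(k div 2 ^ i - 1) * 2 ^ i + 2 ^ i}. x j)" for i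
  have k: "real k \<ge> 1" using False by simp
  have "norm (\<Sum>j<k. x j) / (\<psi> (real k) * real k powr (1 / p)) \<le>
      (\<Sum>i<k. if odd (k div 2 ^ i) then v i else 0) / (\<psi> (real k) * real k powr (1 / p))"
    unfolding v_def using pos[OF k] by (intro divide_right_mono norm_sum_binary_blocks) simp
  also have "\<dots> = (\<Sum>i<k. if odd (k div 2 ^ i) then v i / (\<psi> (real k) * real k powr (1 / p)) else 0)"
    unfolding sum_divide_distrib by (rule sum.cong) auto
  also have "\<dots> \<le> (\<Sum>i<k. if odd (k div 2 ^ i) then 1 / (\<psi> (2 ^ i) * (2 ^ i) powr (1 / p)) *
       (v i * real (Suc (k div 2 ^ i - 1)) powr (- (1 / p))) else 0)"
  proof (rule sum_mono)
    fix i
    show "(if odd (k div 2 ^ i) then v i / (\<psi> (real k) * real k powr (1 / p)) else 0) \<le>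
      (if odd (k div 2 ^ i) then 1 / (\<psi> (2 ^ i) * (2 ^ i) powr (1 / p)) *
       (v i * real (Suc (k div 2 ^ i - 1)) powr (- (1 / p))) else 0)"
    proof (cases "odd (k div 2 ^ i)")
      case True
      define q where "q = k div 2 ^ i"
      \<comment> \<open>Positivity makes the truncated subtraction harmless:
        \<open>Suc (q - 1) = q\<close>.\<close>
      have q: "q > 0" using True unfolding q_def by (metis even_zero gr0I)
      have "2 ^ i * q \<le> k" unfolding q_def by (rule times_div_less_eq_dividend)
      then have qk: "2 ^ i * real q \<le> real k" by (metis of_nat_le_iff of_nat_mult of_nat_numeral of_nat_power)
      have "(2::real) ^ i * 1 \<le> 2 ^ i * real q" using q by (intro mult_left_mono) auto
      then have ik: "2 ^ i \<le> real k" using qk by linarith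
      have "\<psi> (2 ^ i) \<le> \<psi> (real k)" using ik k by (intro mono_onD[OF mono]) auto
      moreover have "(2 ^ i) powr (1 / p) * real q powr (1 / p) \<le> real k powr (1 / p)"
        using qk p by (simp add: powr_mult[symmetric] powr_mono2)
      ultimately have "\<psi> (2 ^ i) * ((2 ^ i) powr (1 / p) * real q powr (1 / p)) \<le> \<psi> (real k) * real k powr (1 / p)"
        using pos[OF k] by (intro mult_mono) auto
      then have "v i / (\<psi> (real k) * real k powr (1 / p)) \<le> v i / (\<psi> (2 ^ i) * ((2 ^ i) powr (1 / p) * real q powr (1 / p)))"
        using pos[of "2 ^ i"] q pos[OF k] False
        by (intro divide_left_mono mult_pos_pos) (auto simp: v_def)
      also have "\<dots> = 1 / (\<psi> (2 ^ i) * (2 ^ i) powr (1 / p)) * (v i * real q powr (- (1 / p)))"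
        by (simp add: powr_minus divide_inverse mult_ac)
      finally show ?thesis using True q by (simp add: q_def[symmetric])
    qed simp
  qed
  finally show ?thesis unfolding v_def .
qed simp

section \<open>Sequences whose block sums have decreasing excesses\<close>

text \<open>Common ground of the two cases. Conditions are put on norms of block sums only, so that
  operators on scalar functions and composition on functions into a nonseparable Banach space both
  fit.\<close>

locale block_contraction = prob_space M for M :: "'a measure" +
  fixes X :: "nat \<Rightarrow> 'a \<Rightarrow> 'b::banach" and p :: real
  assumes p: "1 < p"
    and block_measurable: "(\<lambda>\<omega>. norm (\<Sum>k\<in>{i..<i + n}. X k \<omega>)) \<in> borel_measurable M"
    and block_tail: "0 < c \<Longrightarrow>
      (\<integral>\<^sup>+ \<omega>. ennreal (norm (\<Sum>k\<in>{Suc i..<Suc i + n}. X k \<omega>) - c) \<partial>M)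
      \<le> (\<integral>\<^sup>+ \<omega>. ennreal (norm (\<Sum>k\<in>{i..<i + n}. X k \<omega>) - c) \<partial>M)"
begin

definition block :: "nat \<Rightarrow> nat \<Rightarrow> 'a \<Rightarrow> 'b" where
  "block i n \<omega> = (\<Sum>k\<in>{i..<i + n}. X k \<omega>)"

definition moment :: "nat \<Rightarrow> ennreal" where
  "moment n = (\<integral>\<^sup>+ \<omega>. ennreal (norm (block 0 n \<omega>) powr p) \<partial>M)"

lemma norm_block_measurable [measurable]: "(\<lambda>\<omega>. norm (block i n \<omega>)) \<in> borel_measurable M"
  unfolding block_def by (rule block_measurable)

lemma block_tail_le:
  assumes "0 < c"
  shows "(\<integral>\<^sup>+ \<omega>. ennreal (norm (block i n \<omega>) - c) \<partial>M) \<le> (\<integral>\<^sup>+ \<omega>. ennreal (norm (block 0 n \<omega>) - c) \<partial>M)"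
proof (induction i)
  case (Suc i)
  have "(\<integral>\<^sup>+ \<omega>. ennreal (norm (block (Suc i) n \<omega>) - c) \<partial>M) \<le> (\<integral>\<^sup>+ \<omega>. ennreal (norm (block i n \<omega>) - c) \<partial>M)"
    unfolding block_def using assms by (rule block_tail)
  then show ?case by (rule order_trans[OF _ Suc.IH])
qed simp

text \<open>The blocks may start anywhere: each excess is moved back to the block at
  \<open>0\<close>, and the excesses of this single function add up to its
  \<open>tail_series\<close>. One moment therefore pays for infinitely many blocks.\<close>

lemma nn_integral_tail_series_le:
  assumes "0 < \<tau>"
  shows "(\<Sum>m. ennreal (real (Suc m) powr (- (1 / p))) *
      (\<integral>\<^sup>+ \<omega>. ennreal (norm (block (i m) n \<omega>) - \<tau> * real (Suc m) powr (1 / p)) \<partial>M))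
    \<le> ennreal (p / (p - 1) * \<tau> powr (1 - p)) * moment n"
proof -
  have "(\<Sum>m. ennreal (real (Suc m) powr (- (1 / p))) *
      (\<integral>\<^sup>+ \<omega>. ennreal (norm (block (i m) n \<omega>) - \<tau> * real (Suc m) powr (1 / p)) \<partial>M))
    \<le> (\<Sum>m. ennreal (real (Suc m) powr (- (1 / p))) *
      (\<integral>\<^sup>+ \<omega>. ennreal (norm (block 0 n \<omega>) - \<tau> * real (Suc m) powr (1 / p)) \<partial>M))"
    using assms by (intro suminf_le mult_left_mono block_tail_le) auto
  also have "\<dots> = (\<integral>\<^sup>+ \<omega>. tail_series p \<tau> (norm (block 0 n \<omega>)) \<partial>M)"
    unfolding tail_series_def
    by (subst nn_integral_suminf, measurable) (simp add: nn_integral_cmult)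
  also have "\<dots> \<le> (\<integral>\<^sup>+ \<omega>. ennreal (p / (p - 1) * \<tau> powr (1 - p)) * ennreal (norm (block 0 n \<omega>) powr p) \<partial>M)"
  proof (rule nn_integral_mono)
    fix \<omega>
    show "tail_series p \<tau> (norm (block 0 n \<omega>)) \<le> ennreal (p / (p - 1) * \<tau> powr (1 - p)) * ennreal (norm (block 0 n \<omega>) powr p)"
      using tail_series_le[OF p assms norm_ge_zero] p by (subst ennreal_mult[symmetric]) auto
  qed
  also have "\<dots> = ennreal (p / (p - 1) * \<tau> powr (1 - p)) * moment n"
    unfolding moment_def by (rule nn_integral_cmult) measurable
  finally show ?thesis .
qed

text \<open>A substitute, up to a constant, for contraction of the \<open>p\<close>-norm:
  \<open>tail_series\<close> bounds the \<open>p\<close>-th power from both sides and is built from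
  excesses, which do not grow under shifts.\<close>

lemma nn_integral_block_powr_le:
  "(\<integral>\<^sup>+ \<omega>. ennreal (norm (block i n \<omega>) powr p) \<partial>M) \<le> ennreal (2 powr (p + 1) * (p / (p - 1))) * moment n"
proof (rule ennreal_le_epsilon)
  fix e :: real assume e: "0 < e"
  \<comment> \<open>Values below \<open>2 * \<tau>\<close>, which \<open>tail_series_ge\<close> does
    not reach, contribute at most \<open>(2 * \<tau>) powr p = e\<close>, the total mass being
    \<open>1\<close>.\<close>
  define \<tau> where "\<tau> = e powr (1 / p) / 2"
  have \<tau>: "0 < \<tau>" using e by (simp add: \<tau>_def)
  have \<tau>e: "(2 * \<tau>) powr p = e" using e p by (simp add: \<tau>_def powr_powr)
  have "(\<integral>\<^sup>+ \<omega>. ennreal (norm (block i n \<omega>) powr p) \<partial>M) \<le>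
    (\<integral>\<^sup>+ \<omega>. ennreal (2 powr (p + 1) * \<tau> powr (p - 1)) * tail_series p \<tau> (norm (block i n \<omega>)) + ennreal e \<partial>M)"
  proof (rule nn_integral_mono)
    fix \<omega>
    show "ennreal (norm (block i n \<omega>) powr p) \<le>
      ennreal (2 powr (p + 1) * \<tau> powr (p - 1)) * tail_series p \<tau> (norm (block i n \<omega>)) + ennreal e"
    proof (cases "2 * \<tau> \<le> norm (block i n \<omega>)")
      case True
      then show ?thesis using tail_series_ge[OF p \<tau> True] by (simp add: add_increasing2)
    next
      case False
      then have "norm (block i n \<omega>) powr p \<le> (2 * \<tau>) powr p" using p by (intro powr_mono2) auto
      then have "ennreal (norm (block i n \<omega>) powr p) \<le> ennreal e" unfolding \<tau>e by (rule ennreal_leI)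
      then show ?thesis by (simp add: add_increasing)
    qed
  qed
  also have "\<dots> = ennreal (2 powr (p + 1) * \<tau> powr (p - 1)) * (\<integral>\<^sup>+ \<omega>. tail_series p \<tau> (norm (block i n \<omega>)) \<partial>M) + ennreal e"
    by (simp add: nn_integral_add nn_integral_cmult emeasure_space_1)
  also have "(\<integral>\<^sup>+ \<omega>. tail_series p \<tau> (norm (block i n \<omega>)) \<partial>M) = (\<Sum>m. ennreal (real (Suc m) powr (- (1 / p))) *
      (\<integral>\<^sup>+ \<omega>. ennreal (norm (block i n \<omega>) - \<tau> * real (Suc m) powr (1 / p)) \<partial>M))"
    unfolding tail_series_def
    by (subst nn_integral_suminf, measurable) (simp add: nn_integral_cmult)
  also have "ennreal (2 powr (p + 1) * \<tau> powr (p - 1)) * \<dots> \<le>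
      ennreal (2 powr (p + 1) * \<tau> powr (p - 1)) * (ennreal (p / (p - 1) * \<tau> powr (1 - p)) * moment n)"
    by (intro mult_left_mono nn_integral_tail_series_le \<tau>) simp
  \<comment> \<open>The powers of \<open>\<tau>\<close> from the upper and lower estimates cancel,
    so the constant is independent of \<open>e\<close>.\<close>
  also have "\<dots> = ennreal (2 powr (p + 1) * (p / (p - 1))) * moment n"
  proof -
    have "2 powr (p + 1) * \<tau> powr (p - 1) * (p / (p - 1) * \<tau> powr (1 - p)) = 2 powr (p + 1) * (p / (p - 1)) * (\<tau> powr (p - 1) * \<tau> powr (1 - p))"
      by (simp only: mult_ac)
    also have "\<tau> powr (p - 1) * \<tau> powr (1 - p) = 1" using \<tau> by (simp add: powr_add[symmetric])
    finally have "2 powr (p + 1) * \<tau> powr (p - 1) * (p / (p - 1) * \<tau> powr (1 - p)) = 2 powr (p + 1) * (p / (p - 1))" by simp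
    moreover have "ennreal (2 powr (p + 1) * \<tau> powr (p - 1)) * (ennreal (p / (p - 1) * \<tau> powr (1 - p)) * moment n) =
        ennreal (2 powr (p + 1) * \<tau> powr (p - 1) * (p / (p - 1) * \<tau> powr (1 - p))) * moment n"
      using p by (subst (3) ennreal_mult) (simp_all add: mult.assoc)
    ultimately show ?thesis by (simp only:)
  qed
  finally show "(\<integral>\<^sup>+ \<omega>. ennreal (norm (block i n \<omega>) powr p) \<partial>M) \<le> ennreal (2 powr (p + 1) * (p / (p - 1))) * moment n + ennreal e"
    by (simp add: add_right_mono)
qed

text \<open>The first \<open>N\<close> terms are the first \<open>n + N\<close> terms minus a block
  of length \<open>n\<close> starting at \<open>N\<close>, whose moment is controlled by
  \<open>moment n\<close>.\<close>

lemma moment_quasi_mono: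
  obtains \<kappa> where "0 \<le> \<kappa>"
    "\<And>n N. moment n < \<infinity> \<Longrightarrow> moment (n + N) < \<infinity> \<Longrightarrow>
      enn2real (moment N) powr (1 / p) \<le>
        \<kappa> * (enn2real (moment (n + N)) powr (1 / p) + enn2real (moment n) powr (1 / p))"
proof
  \<comment> \<open>The maximum with \<open>1\<close> gives \<open>u \<le> L * max u v\<close> at
    once; in \<open>K\<close>, \<open>2 powr p\<close> comes from the power of a sum and
    \<open>2 * L\<close> from bounding \<open>u + L * v\<close>.\<close>
  define L where "L = max 1 (2 powr (p + 1) * (p / (p - 1)))"
  define K where "K = 2 powr p * 2 * L"
  have K0: "K \<ge> 0" by (simp add: K_def L_def)
  show "0 \<le> K powr (1 / p)" by simp
  fix n N assume fin: "moment n < \<infinity>" "moment (n + N) < \<infinity>"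
  define u where "u = enn2real (moment (n + N))"
  define v where "v = enn2real (moment n)"
  have uv: "moment (n + N) = ennreal u" "moment n = ennreal v" "u \<ge> 0" "v \<ge> 0"
    using fin by (simp_all add: u_def v_def)
  have split: "block 0 N \<omega> = block 0 (n + N) \<omega> - block N n \<omega>" for \<omega>
  proof -
    have "(\<Sum>k\<in>{0..<N}. X k \<omega>) + (\<Sum>k\<in>{N..<N + n}. X k \<omega>) = (\<Sum>k\<in>{0..<N + n}. X k \<omega>)"
      by (rule sum.atLeastLessThan_concat) auto
    then show ?thesis by (simp add: block_def add.commute eq_diff_eq)
  qed
  have powr_add_le: "(x + y) powr p \<le> 2 powr p * (x powr p + y powr p)" if "0 \<le> x" "0 \<le> y" for x y :: real
  proof -
    have "(x + y) powr p \<le> (2 * max x y) powr p" using that p by (intro powr_mono2) auto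
    also have "\<dots> = 2 powr p * max x y powr p" using that by (simp add: powr_mult)
    also have "max x y powr p \<le> x powr p + y powr p" by (simp add: max_def)
    finally show ?thesis by simp
  qed
  have "moment N \<le> (\<integral>\<^sup>+ \<omega>. ennreal (2 powr p) * (ennreal (norm (block 0 (n + N) \<omega>) powr p) + ennreal (norm (block N n \<omega>) powr p)) \<partial>M)"
    unfolding moment_def
  proof (rule nn_integral_mono)
    fix \<omega>
    have "norm (block 0 N \<omega>) powr p \<le> (norm (block 0 (n + N) \<omega>) + norm (block N n \<omega>)) powr p"
      unfolding split using p by (intro powr_mono2 norm_triangle_ineq4) auto
    also have "\<dots> \<le> 2 powr p * (norm (block 0 (n + N) \<omega>) powr p + norm (block N n \<omega>) powr p)"
      by (intro powr_add_le) auto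
    finally show "ennreal (norm (block 0 N \<omega>) powr p) \<le> ennreal (2 powr p) * (ennreal (norm (block 0 (n + N) \<omega>) powr p) + ennreal (norm (block N n \<omega>) powr p))"
      by (simp add: ennreal_mult[symmetric] ennreal_plus[symmetric] ennreal_leI del: ennreal_plus)
  qed
  also have "\<dots> = ennreal (2 powr p) * (moment (n + N) + (\<integral>\<^sup>+ \<omega>. ennreal (norm (block N n \<omega>) powr p) \<partial>M))"
    by (simp add: nn_integral_add nn_integral_cmult moment_def)
  also have "\<dots> \<le> ennreal (2 powr p) * (ennreal u + ennreal L * ennreal v)"
  proof (intro mult_left_mono add_mono)
    have "(\<integral>\<^sup>+ \<omega>. ennreal (norm (block N n \<omega>) powr p) \<partial>M) \<le> ennreal (2 powr (p + 1) * (p / (p - 1))) * moment n"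
      by (rule nn_integral_block_powr_le)
    also have "\<dots> \<le> ennreal L * ennreal v"
      unfolding uv by (intro mult_right_mono ennreal_leI) (auto simp: L_def)
    finally show "(\<integral>\<^sup>+ \<omega>. ennreal (norm (block N n \<omega>) powr p) \<partial>M) \<le> ennreal L * ennreal v" .
  qed (simp_all add: uv)
  also have "\<dots> = ennreal (2 powr p * (u + L * v))"
    using uv by (simp add: ennreal_mult[symmetric] ennreal_plus[symmetric] L_def del: ennreal_plus)
  also have "\<dots> \<le> ennreal (K * max u v)"
  proof (rule ennreal_leI)
    have "L \<ge> 1" by (simp add: L_def)
    then have "u \<le> L * max u v" using uv mult_mono[of 1 L u "max u v"] by auto
    moreover have "L * v \<le> L * max u v" using \<open>L \<ge> 1\<close> by (intro mult_left_mono) auto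
    ultimately have "u + L * v \<le> 2 * L * max u v" by linarith
    then have "2 powr p * (u + L * v) \<le> 2 powr p * (2 * L * max u v)" by (intro mult_left_mono) auto
    then show "2 powr p * (u + L * v) \<le> K * max u v" by (simp add: K_def mult_ac)
  qed
  finally have "enn2real (moment N) \<le> K * max u v"
    using K0 uv by (simp add: enn2real_leI)
  then have "enn2real (moment N) powr (1 / p) \<le> (K * max u v) powr (1 / p)"
    using p by (intro powr_mono2) auto
  also have "\<dots> = K powr (1 / p) * max u v powr (1 / p)" using K0 uv by (simp add: powr_mult)
  also have "\<dots> \<le> K powr (1 / p) * (u powr (1 / p) + v powr (1 / p))"
    by (intro mult_left_mono) (auto simp: max_def)
  finally show "enn2real (moment N) powr (1 / p) \<le>
      K powr (1 / p) * (enn2real (moment (n + N)) powr (1 / p) + enn2real (moment n) powr (1 / p))"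
    unfolding u_def v_def .
qed

end

section \<open>Weighted excesses, the maximal estimate and almost sure convergence\<close>

text \<open>Thresholds proportional to \<open>A j\<close> turn the bound into
  \<open>(s * A j) powr (1 - p) * A j powr p = s powr (1 - p) * A j\<close>, which is linear in
  \<open>A j\<close>; summability of \<open>c j * A j\<close> is then enough.\<close>

lemma (in block_contraction) nn_integral_weighted_excess_le:
  fixes c A :: "nat \<Rightarrow> real"
  assumes c: "\<And>j. 0 \<le> c j" and A: "\<And>j. 0 < A j" and sm: "summable (\<lambda>j. c j * A j)"
    and moment: "\<And>j. moment (2 ^ j) \<le> ennreal (A j powr p)" and s: "0 < s"
  shows "(\<integral>\<^sup>+ \<omega>. (\<Sum>j. ennreal (c j) *
      (\<Sum>m. ennreal (norm (block (m * 2 ^ j) (2 ^ j) \<omega>) * real (Suc m) powr (- (1 / p)) - s * A j))) \<partial>M)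
    \<le> ennreal (p / (p - 1) * s powr (1 - p) * (\<Sum>j. c j * A j))"
proof -
  define K where "K = p / (p - 1)"
  have K0: "0 \<le> K" using p by (simp add: K_def)
  \<comment> \<open>Pulling out the normalising factor produces the growing thresholds of
    \<open>tail_series\<close>.\<close>
  have scale: "ennreal (x * real (Suc m) powr (- (1 / p)) - \<tau>) =
      ennreal (real (Suc m) powr (- (1 / p))) * ennreal (x - \<tau> * real (Suc m) powr (1 / p))" for x \<tau> m
  proof -
    have "x * real (Suc m) powr (- (1 / p)) - \<tau> =
      real (Suc m) powr (- (1 / p)) * (x - \<tau> * real (Suc m) powr (1 / p))"
      by (simp add: powr_minus field_simps del: of_nat_Suc)
    then show ?thesis by (simp only:) (rule ennreal_mult', simp)
  qed
  have inner: "(\<integral>\<^sup>+ \<omega>. (\<Sum>m. ennreal (norm (block (m * 2 ^ j) (2 ^ j) \<omega>) * real (Suc m) powr (- (1 / p)) - s * A j)) \<partial>M)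
      \<le> ennreal (K * s powr (1 - p) * A j)" for j
  proof -
    have sA: "0 < s * A j" using s A by simp
    have "(\<integral>\<^sup>+ \<omega>. (\<Sum>m. ennreal (norm (block (m * 2 ^ j) (2 ^ j) \<omega>) * real (Suc m) powr (- (1 / p)) - s * A j)) \<partial>M) =
      (\<Sum>m. ennreal (real (Suc m) powr (- (1 / p))) *
        (\<integral>\<^sup>+ \<omega>. ennreal (norm (block (m * 2 ^ j) (2 ^ j) \<omega>) - (s * A j) * real (Suc m) powr (1 / p)) \<partial>M))"
      unfolding scale by (subst nn_integral_suminf, measurable) (simp add: nn_integral_cmult)
    also have "\<dots> \<le> ennreal (K * (s * A j) powr (1 - p)) * moment (2 ^ j)"
      unfolding K_def by (rule nn_integral_tail_series_le[OF sA])
    also have "\<dots> \<le> ennreal (K * (s * A j) powr (1 - p)) * ennreal (A j powr p)"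
      by (intro mult_left_mono moment) simp
    also have "\<dots> = ennreal (K * s powr (1 - p) * (A j powr (1 - p) * A j powr p))"
      using K0 s A[of j] by (simp add: ennreal_mult[symmetric] powr_mult mult_ac)
    also have "A j powr (1 - p) * A j powr p = A j" using A[of j] by (simp add: powr_add[symmetric])
    finally show ?thesis .
  qed
  have "(\<integral>\<^sup>+ \<omega>. (\<Sum>j. ennreal (c j) *
      (\<Sum>m. ennreal (norm (block (m * 2 ^ j) (2 ^ j) \<omega>) * real (Suc m) powr (- (1 / p)) - s * A j))) \<partial>M)
    = (\<Sum>j. ennreal (c j) * (\<integral>\<^sup>+ \<omega>.
      (\<Sum>m. ennreal (norm (block (m * 2 ^ j) (2 ^ j) \<omega>) * real (Suc m) powr (- (1 / p)) - s * A j)) \<partial>M))"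
    by (subst nn_integral_suminf, measurable) (simp add: nn_integral_cmult)
  also have "\<dots> \<le> (\<Sum>j. ennreal (c j) * ennreal (K * s powr (1 - p) * A j))"
    by (intro suminf_le mult_left_mono inner) auto
  also have "\<dots> = (\<Sum>j. ennreal (K * s powr (1 - p) * (c j * A j)))"
    using K0 c A by (intro suminf_cong) (simp add: ennreal_mult[symmetric] less_imp_le mult_ac)
  also have "\<dots> = ennreal (\<Sum>j. K * s powr (1 - p) * (c j * A j))"
    using K0 c A sm by (intro suminf_ennreal2 summable_mult) (simp_all add: less_imp_le)
  also have "(\<Sum>j. K * s powr (1 - p) * (c j * A j)) = K * s powr (1 - p) * (\<Sum>j. c j * A j)"
    by (rule suminf_mult[OF sm])
  finally show ?thesis unfolding K_def .
qed

text \<open>Write a selected entry as \<open>s * A i\<close> plus a remainder. The positive part of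
  the remainder is one term of the sum over all \<open>m\<close>, so the bound is uniform in the
  selection and in \<open>k\<close>.\<close>

lemma ennreal_sum_le_suminf_excess:
  fixes c A y :: "nat \<Rightarrow> real" and Y :: "nat \<Rightarrow> nat \<Rightarrow> real"
  assumes c: "\<And>j. 0 \<le> c j" and A: "\<And>j. 0 < A j" and sm: "summable (\<lambda>j. c j * A j)" and s: "0 \<le> s"
    and y: "\<And>i. i < k \<Longrightarrow> y i = 0 \<or> (\<exists>m. y i = c i * Y i m)"
  shows "ennreal (\<Sum>i<k. y i) \<le> ennreal (s * (\<Sum>j. c j * A j)) + (\<Sum>j. ennreal (c j) * (\<Sum>m. ennreal (Y j m - s * A j)))"
proof -
  define H where "H j = ennreal (c j) * (\<Sum>m. ennreal (Y j m - s * A j))" for j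
  have yle: "ennreal (y i) \<le> ennreal (s * (c i * A i)) + H i" if "i < k" for i
    using y[OF that]
  proof
    assume "\<exists>m. y i = c i * Y i m"
    then obtain m where m: "y i = c i * Y i m" by blast
    have "ennreal (Y i m - s * A i) \<le> (\<Sum>m. ennreal (Y i m - s * A i))"
      using sum_le_suminf[of "\<lambda>m. ennreal (Y i m - s * A i)" "{m}"] by simp
    then have "ennreal (c i) * ennreal (Y i m - s * A i) \<le> H i"
      unfolding H_def by (rule mult_left_mono) simp
    moreover have "ennreal (y i) \<le> ennreal (s * (c i * A i)) + ennreal (c i * (Y i m - s * A i))"
    proof -
      have "y i = s * (c i * A i) + c i * (Y i m - s * A i)" by (simp add: m algebra_simps)
      also have "\<dots> \<le> s * (c i * A i) + max 0 (c i * (Y i m - s * A i))" by simp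
      finally have "ennreal (y i) \<le> ennreal (s * (c i * A i) + max 0 (c i * (Y i m - s * A i)))"
        by (rule ennreal_leI)
      then show ?thesis using s c[of i] A[of i] by (simp add: ennreal_plus less_imp_le ennreal_max_0)
    qed
    ultimately show ?thesis using c[of i] by (simp add: ennreal_mult') (meson add_left_mono order_trans)
  qed simp
  have "ennreal (\<Sum>i<k. y i) \<le> (\<Sum>i<k. ennreal (y i))"
  proof (induction k)
    case (Suc k)
    have "ennreal (sum y {..<k} + y k) \<le> ennreal (sum y {..<k}) + ennreal (y k)"
    proof -
      have "ennreal (sum y {..<k} + y k) \<le> ennreal (max 0 (sum y {..<k}) + max 0 (y k))"
        by (intro ennreal_leI add_mono) auto
      also have "\<dots> = ennreal (sum y {..<k}) + ennreal (y k)" by (simp add: ennreal_plus ennreal_max_0)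
      finally show ?thesis .
    qed
    also have "\<dots> \<le> (\<Sum>i<k. ennreal (y i)) + ennreal (y k)" by (rule add_right_mono[OF Suc])
    finally show ?case by simp
  qed simp
  also have "\<dots> \<le> (\<Sum>i<k. ennreal (s * (c i * A i)) + H i)" by (intro sum_mono yle) auto
  also have "\<dots> \<le> (\<Sum>i. ennreal (s * (c i * A i)) + H i)" by (rule sum_le_suminf) auto
  also have "\<dots> = (\<Sum>i. ennreal (s * (c i * A i))) + (\<Sum>i. H i)" by (rule suminf_add[symmetric]) auto
  also have "(\<Sum>i. ennreal (s * (c i * A i))) = ennreal (\<Sum>i. s * (c i * A i))"
    using s c A sm by (intro suminf_ennreal2 summable_mult) (simp_all add: less_imp_le)
  also have "(\<Sum>i. s * (c i * A i)) = s * (\<Sum>j. c j * A j)" by (rule suminf_mult[OF sm])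
  finally show ?thesis by (simp add: H_def)
qed

text \<open>Finite excess sums at arbitrarily small thresholds force each row to tend to
  \<open>0\<close>, and the threshold \<open>A j\<close> itself (\<open>n = 0\<close>) supplies a
  summable majorant; Tannery's theorem then exchanges limit and sum.\<close>

lemma tendsto_sum_selected_entries:
  fixes c A :: "nat \<Rightarrow> real" and Y :: "nat \<Rightarrow> nat \<Rightarrow> real"
  assumes c: "\<And>j. 0 \<le> c j" and A: "\<And>j. 0 < A j" and sm: "summable (\<lambda>j. c j * A j)"
    and Y: "\<And>j m. 0 \<le> Y j m"
    and fin: "\<And>n. (\<Sum>j. ennreal (c j) * (\<Sum>m. ennreal (Y j m - 1 / real (Suc n) * A j))) \<noteq> \<infinity>"
    and sel: "\<And>i. filterlim (\<lambda>k. g k i) at_top at_top"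
  shows "(\<lambda>k. \<Sum>i<k. if P k i then c i * Y i (g k i) else 0) \<longlonglongrightarrow> 0"
proof -
  define E where "E n j = (\<Sum>m. ennreal (Y j m - 1 / real (Suc n) * A j))" for n j
  \<comment> \<open>In \<open>ennreal\<close>, \<open>0 * \<infinity> = 0\<close>, so finiteness of
    the weighted sum says nothing about rows of weight zero.\<close>
  have Efin: "c j = 0 \<or> E n j \<noteq> \<infinity>" for n j
  proof -
    have "ennreal (c j) * E n j \<le> (\<Sum>j. ennreal (c j) * E n j)"
      using sum_le_suminf[of "\<lambda>j. ennreal (c j) * E n j" "{j}"] by simp
    then have "ennreal (c j) * E n j \<noteq> \<infinity>" using fin[of n] unfolding E_def[symmetric] by (auto simp: top_unique)
    then show ?thesis using c[of j] by (auto simp: ennreal_mult_eq_top_iff)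
  qed
  have lim: "(\<lambda>m. c j * Y j m) \<longlonglongrightarrow> 0" for j
  proof (cases "c j = 0")
    case False
    have "Y j \<longlonglongrightarrow> 0"
    proof (rule LIMSEQ_I)
      fix r :: real assume r: "0 < r"
      obtain n where "A j / (r / 2) < real n" using reals_Archimedean2 by blast
      then have n: "A j / (r / 2) < real (Suc n)" by simp
      have nA: "1 / real (Suc n) * A j < r / 2" using n r by (simp add: field_simps)
      have "(\<Sum>m. ennreal (max 0 (Y j m - 1 / real (Suc n) * A j))) \<noteq> top"
        using Efin[of j n] False by (simp add: E_def ennreal_max_0)
      then have "summable (\<lambda>m. max 0 (Y j m - 1 / real (Suc n) * A j))"
        by (intro summable_suminf_not_top) auto
      from LIMSEQ_D[OF summable_LIMSEQ_zero[OF this], of "r / 2"] r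
      obtain N where N: "\<And>m. m \<ge> N \<Longrightarrow> max 0 (Y j m - 1 / real (Suc n) * A j) < r / 2" by auto
      have "norm (Y j m - 0) < r" if "m \<ge> N" for m
      proof -
        have "Y j m - 1 / real (Suc n) * A j < r / 2"
          using N[OF that] by (rule le_less_trans[OF max.cobounded2])
        then have "Y j m < r" using nA by linarith
        then show ?thesis using Y[of j m] by simp
      qed
      then show "\<exists>N. \<forall>m\<ge>N. norm (Y j m - 0) < r" by blast
    qed
    then show ?thesis by (rule tendsto_mult_right_zero)
  qed simp
  \<comment> \<open>Extension by \<open>0\<close> beyond \<open>k\<close> turns sums of varying
    length into series.\<close>
  define a where "a i k = (if i < k \<and> P k i then c i * Y i (g k i) else 0)" for i k
  define B where "B i = c i * A i + c i * enn2real (E 0 i)" for i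
  have "summable (\<lambda>i. c i * enn2real (E 0 i))"
  proof (rule summable_suminf_not_top)
    have "ennreal (c i * enn2real (E 0 i)) = ennreal (c i) * E 0 i" for i
      using Efin[of i 0] c[of i] by (auto simp: ennreal_mult less_top)
    then show "(\<Sum>i. ennreal (c i * enn2real (E 0 i))) \<noteq> top"
      using fin[of 0] unfolding E_def[symmetric] by simp
  qed (simp add: c)
  then have B: "summable B" unfolding B_def by (rule summable_add[OF sm])
  have bound: "norm (a i k) \<le> B i" for i k
  proof -
    have cY: "c i * Y i m \<le> B i" for m
    proof (cases "c i = 0")
      case False
      have "ennreal (Y i m - A i) \<le> E 0 i"
        unfolding E_def using sum_le_suminf[of "\<lambda>m. ennreal (Y i m - A i)" "{m}"] by simp
      then have "Y i m - A i \<le> enn2real (E 0 i)" using Efin[of i 0] False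
        by (metis ennreal_enn2real_if ennreal_le_iff enn2real_nonneg infinity_ennreal_def)
      then have "c i * Y i m \<le> c i * (A i + enn2real (E 0 i))" using c[of i] by (intro mult_left_mono) auto
      then show ?thesis by (simp add: B_def distrib_left)
    qed (simp add: B_def)
    have "0 \<le> B i" using c[of i] A[of i] by (simp add: B_def)
    then show ?thesis using cY c[of i] Y by (simp add: a_def)
  qed
  have alim: "(\<lambda>k. a i k) \<longlonglongrightarrow> 0" for i
  proof (rule tendsto_sandwich[OF _ _ tendsto_const])
    show "(\<lambda>k. c i * Y i (g k i)) \<longlonglongrightarrow> 0" by (rule filterlim_compose[OF lim sel])
    show "\<forall>\<^sub>F k in sequentially. 0 \<le> a i k" using c Y by (simp add: a_def)
    show "\<forall>\<^sub>F k in sequentially. a i k \<le> c i * Y i (g k i)" using c Y by (simp add: a_def)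
  qed
  have "(\<lambda>k. suminf (\<lambda>i. a i k)) \<longlonglongrightarrow> (\<Sum>i. 0)"
    by (rule tannerys_theorem[of a "\<lambda>_. 0" sequentially B, THEN conjunct2, THEN conjunct2, OF alim _ B])
      (use bound in \<open>auto intro!: always_eventually\<close>)
  moreover have "suminf (\<lambda>i. a i k) = (\<Sum>i<k. if P k i then c i * Y i (g k i) else 0)" for k
    by (subst suminf_finite[of "{..<k}"]) (auto simp: a_def)
  ultimately show ?thesis by simp
qed

context block_contraction
begin

text \<open>For fixed \<open>s\<close>, the function \<open>Z s\<close> dominates all normalised
  sums at once, up to the constant \<open>s * S\<close>, so taking the supremum over
  \<open>n\<close> costs nothing.\<close>

lemma maximal_and_convergence:
  fixes \<psi> :: "real \<Rightarrow> real" and a :: "nat \<Rightarrow> real"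
  assumes pos: "\<And>x. x \<ge> 1 \<Longrightarrow> \<psi> x > 0" and mono: "mono_on {1..} \<psi>"
    and sm: "summable (\<lambda>j. a j / (\<psi> (2 ^ j) * (2 ^ j) powr (1 / p)))"
    and a: "\<And>j. 0 \<le> a j" and moment: "\<And>j. moment (2 ^ j) \<le> ennreal (a j powr p)"
  shows "(\<lambda>\<omega>. SUP n\<in>{1..}. ennreal (norm (\<Sum>k<n. X k \<omega>) / (\<psi> (real n) * real n powr (1 / p)))) \<in> weak_Lp M p"
    and "AE \<omega> in M. (\<lambda>n. norm (\<Sum>k<n. X k \<omega>) / (\<psi> (real n) * real n powr (1 / p))) \<longlonglongrightarrow> 0"
proof -
  define D where "D n \<omega> = norm (\<Sum>k<n. X k \<omega>) / (\<psi> (real n) * real n powr (1 / p))" for n \<omega>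
  define c where "c j = 1 / (\<psi> (2 ^ j) * (2 ^ j) powr (1 / p))" for j :: nat
  \<comment> \<open>The summand \<open>(1 / 2) ^ j\<close> makes the thresholds positive where the moment vanishes.\<close>
  define A where "A j = a j + (1 / 2) ^ j" for j
  define Y where "Y \<omega> j m = norm (block (m * 2 ^ j) (2 ^ j) \<omega>) * real (Suc m) powr (- (1 / p))" for \<omega> j m
  define Z where "Z s \<omega> = (\<Sum>j. ennreal (c j) * (\<Sum>m. ennreal (Y \<omega> j m - s * A j)))" for s \<omega>
  define S where "S = (\<Sum>j. c j * A j)"
  have pos2: "\<psi> (2 ^ j) > 0" for j by (rule pos) simp
  have c0: "0 < c j" for j using pos2[of j] by (simp add: c_def)
  \<comment> \<open>Bounded weights keep the series summable after the geometric summand of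
    \<open>A\<close> is added.\<close>
  have c_le: "c j \<le> 1 / \<psi> 1" for j
  proof -
    have "\<psi> 1 \<le> \<psi> (2 ^ j)" by (intro mono_onD[OF mono]) auto
    moreover have "(2 ^ j) powr (1 / p) \<ge> (1 :: real)" using p by (intro ge_one_powr_ge_zero) auto
    ultimately have "\<psi> 1 * 1 \<le> \<psi> (2 ^ j) * (2 ^ j) powr (1 / p)" using pos[of 1] pos2[of j] by (intro mult_mono) auto
    then show ?thesis unfolding c_def using pos[of 1] pos2[of j] by (intro divide_left_mono) auto
  qed
  have A0: "0 < A j" for j using a[of j] by (simp add: A_def add_nonneg_pos)
  have smA: "summable (\<lambda>j. c j * A j)"
  proof -
    have "summable (\<lambda>j. 1 / \<psi> 1 * (1 / 2) ^ j)" by (intro summable_mult summable_geometric) simp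
    moreover have "norm (c j * (1 / 2) ^ j) \<le> 1 / \<psi> 1 * (1 / 2) ^ j" for j
      using mult_right_mono[OF c_le[of j], of "(1 / 2) ^ j"] c0[of j] by simp
    ultimately have "summable (\<lambda>j. c j * (1 / 2) ^ j)"
      by (rule summable_comparison_test'[where N = 0])
    moreover have "summable (\<lambda>j. c j * a j)" using sm by (simp add: c_def)
    ultimately have "summable (\<lambda>j. c j * a j + c j * (1 / 2) ^ j)" by (rule summable_add[rotated])
    then show ?thesis by (simp add: A_def distrib_left)
  qed
  have S0: "0 < S" unfolding S_def using smA c0 A0 by (intro suminf_pos) auto
  have momentA: "moment (2 ^ j) \<le> ennreal (A j powr p)" for j
    using moment[of j] by (rule order_trans) (use a p in \<open>auto intro!: ennreal_leI powr_mono2 simp: A_def\<close>)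
  have Y0: "0 \<le> Y \<omega> j m" for \<omega> j m by (simp add: Y_def)
  have [measurable]: "(\<lambda>\<omega>. Y \<omega> j m) \<in> borel_measurable M" for j m unfolding Y_def by measurable
  have [measurable]: "Z s \<in> borel_measurable M" for s unfolding Z_def by measurable
  have [measurable]: "D n \<in> borel_measurable M" for n
    using norm_block_measurable[of 0 n] unfolding D_def [abs_def] block_def by (simp add: lessThan_atLeast0)
  have EZ: "(\<integral>\<^sup>+ \<omega>. Z s \<omega> \<partial>M) \<le> ennreal (p / (p - 1) * s powr (1 - p) * S)" if "0 < s" for s
    unfolding Z_def Y_def S_def using c0 A0 smA momentA that
    by (intro nn_integral_weighted_excess_le) (auto simp: less_imp_le)
  have D_le: "D k \<omega> \<le> (\<Sum>i<k. if odd (k div 2 ^ i) then c i * Y \<omega> i (k div 2 ^ i - 1) else 0)" for k \<omega>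
    unfolding D_def c_def Y_def block_def using p by (intro weighted_norm_sum_le pos mono) auto
  have D_le_Z: "ennreal (D k \<omega>) \<le> ennreal (s * S) + Z s \<omega>" if "0 < s" for k \<omega> s
  proof -
    have "ennreal (D k \<omega>) \<le> ennreal (\<Sum>i<k. if odd (k div 2 ^ i) then c i * Y \<omega> i (k div 2 ^ i - 1) else 0)"
      by (intro ennreal_leI D_le)
    also have "\<dots> \<le> ennreal (s * S) + Z s \<omega>"
      unfolding S_def Z_def using c0 A0 smA that by (intro ennreal_sum_le_suminf_excess) (auto simp: less_imp_le)
    finally show ?thesis .
  qed
  define G where "G \<omega> = (SUP n\<in>{1..}. ennreal (D n \<omega>))" for \<omega>
  have [measurable]: "G \<in> borel_measurable M" unfolding G_def [abs_def] by measurable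
  \<comment> \<open>The value of
    \<open>t powr p * (2 / t) * (p / (p - 1)) * s powr (1 - p) * S\<close> at
    \<open>s = t / (2 * S)\<close>, where the powers of \<open>t\<close> cancel.\<close>
  define K where "K = 2 * (p / (p - 1)) * (2 * S) powr (p - 1) * S"
  have weak: "ennreal (t powr p) * emeasure M {\<omega>\<in>space M. ennreal t \<le> G \<omega>} \<le> ennreal K" if t: "0 < t" for t
  proof -
    \<comment> \<open>Half of the level \<open>t\<close> absorbs the constant \<open>s * S\<close>;
      the other half must come from \<open>Z s\<close>, to which Markov's inequality
      applies.\<close>
    define s where "s = t / (2 * S)"
    have s: "0 < s" "s * S = t / 2" using t S0 by (simp_all add: s_def)
    have "{\<omega>\<in>space M. ennreal t \<le> G \<omega>} \<subseteq> {\<omega>\<in>space M. 1 \<le> ennreal (2 / t) * Z s \<omega>}"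
    proof safe
      fix \<omega> assume "ennreal t \<le> G \<omega>"
      also have "G \<omega> \<le> ennreal (t / 2) + Z s \<omega>"
        unfolding G_def using D_le_Z[OF s(1)] s(2) by (intro SUP_least) simp
      finally have le: "ennreal t \<le> ennreal (t / 2) + Z s \<omega>" .
      have "ennreal (t / 2) \<le> Z s \<omega>"
      proof (cases "Z s \<omega>")
        case (real z)
        then have "t \<le> t / 2 + z" using le t by (simp add: ennreal_plus[symmetric] del: ennreal_plus)
        then show ?thesis using real by (simp add: ennreal_leI)
      qed simp
      then have "ennreal (2 / t) * ennreal (t / 2) \<le> ennreal (2 / t) * Z s \<omega>" by (rule mult_left_mono) simp
      then show "1 \<le> ennreal (2 / t) * Z s \<omega>" using t by (simp add: ennreal_mult[symmetric])
    qed
    then have "emeasure M {\<omega>\<in>space M. ennreal t \<le> G \<omega>} \<le> emeasure M {\<omega>\<in>space M. 1 \<le> ennreal (2 / t) * Z s \<omega>}"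
      by (intro emeasure_mono) auto
    also have "\<dots> \<le> ennreal (2 / t) * (\<integral>\<^sup>+ \<omega>. Z s \<omega> * indicator (space M) \<omega> \<partial>M)"
      by (rule nn_integral_Markov_inequality) auto
    also have "(\<integral>\<^sup>+ \<omega>. Z s \<omega> * indicator (space M) \<omega> \<partial>M) = (\<integral>\<^sup>+ \<omega>. Z s \<omega> \<partial>M)"
      by (intro nn_integral_cong) simp
    also have "ennreal (2 / t) * \<dots> \<le> ennreal (2 / t) * ennreal (p / (p - 1) * s powr (1 - p) * S)"
      by (intro mult_left_mono EZ s) simp
    finally have "ennreal (t powr p) * emeasure M {\<omega>\<in>space M. ennreal t \<le> G \<omega>} \<le>
        ennreal (t powr p) * (ennreal (2 / t) * ennreal (p / (p - 1) * s powr (1 - p) * S))"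
      by (rule mult_left_mono) simp
    also have "\<dots> = ennreal (t powr p * (2 / t * (p / (p - 1) * s powr (1 - p) * S)))"
      using t p S0 by (simp add: ennreal_mult[symmetric])
    also have "t powr p * (2 / t * (p / (p - 1) * s powr (1 - p) * S)) = K"
    proof -
      have "s powr (1 - p) = t powr (1 - p) * (2 * S) powr (p - 1)"
        unfolding s_def using t S0 by (simp add: powr_divide powr_diff)
      moreover have "t powr p * (t powr (1 - p) / t) = 1"
        using t by (simp add: powr_diff)
      ultimately show ?thesis unfolding K_def
        by (simp add: divide_inverse) (metis (no_types, lifting) mult.assoc mult.commute mult_1)
    qed
    finally show ?thesis .
  qed
  have "(SUP t\<in>{0<..}. ennreal (t powr p) * emeasure M {\<omega>\<in>space M. ennreal t \<le> G \<omega>}) \<le> ennreal K"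
    using weak by (intro SUP_least) auto
  then have "G \<in> weak_Lp M p"
    unfolding weak_Lp_def by (auto intro: le_less_trans)
  then show "(\<lambda>\<omega>. SUP n\<in>{1..}. ennreal (norm (\<Sum>k<n. X k \<omega>) / (\<psi> (real n) * real n powr (1 / p)))) \<in> weak_Lp M p"
    unfolding G_def [abs_def] D_def .
  \<comment> \<open>Countably many small thresholds leave a single exceptional null set.\<close>
  have "AE \<omega> in M. Z (1 / real (Suc n)) \<omega> \<noteq> \<infinity>" for n
    by (rule nn_integral_PInf_AE) (use EZ[of "1 / real (Suc n)"] in \<open>auto simp: top_unique\<close>)
  then have "AE \<omega> in M. \<forall>n. Z (1 / real (Suc n)) \<omega> \<noteq> \<infinity>" by (simp only: AE_all_countable) simp
  then have "AE \<omega> in M. (\<lambda>k. D k \<omega>) \<longlonglongrightarrow> 0"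
  proof eventually_elim
    case (elim \<omega>)
    \<comment> \<open>At every fixed scale the index of the selected block escapes to
      infinity.\<close>
    have sel: "filterlim (\<lambda>k :: nat. k div 2 ^ i - 1) at_top at_top" for i :: nat
      unfolding filterlim_at_top
    proof
      fix N :: nat
      show "\<forall>\<^sub>F k in at_top. N \<le> k div 2 ^ i - 1"
        using eventually_ge_at_top[of "(N + 1) * 2 ^ i"]
      proof eventually_elim
        case (elim k)
        then have "(N + 1) * 2 ^ i div 2 ^ i \<le> k div 2 ^ i" by (rule div_le_mono)
        then show ?case by simp
      qed
    qed
    show ?case
    proof (rule tendsto_sandwich[OF _ _ tendsto_const])
      show "(\<lambda>k. \<Sum>i<k. if odd (k div 2 ^ i) then c i * Y \<omega> i (k div 2 ^ i - 1) else 0) \<longlonglongrightarrow> 0"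
        by (rule tendsto_sum_selected_entries[OF _ A0 smA Y0 _ sel])
          (use c0 elim in \<open>auto simp: less_imp_le Z_def\<close>)
      show "\<forall>\<^sub>F k in sequentially. 0 \<le> D k \<omega>"
        using eventually_ge_at_top[of 1]
      proof eventually_elim
        case (elim k)
        then have "0 < \<psi> (real k)" by (intro pos) simp
        then show ?case by (simp add: D_def)
      qed
      show "\<forall>\<^sub>F k in sequentially. D k \<omega> \<le> (\<Sum>i<k. if odd (k div 2 ^ i) then c i * Y \<omega> i (k div 2 ^ i - 1) else 0)"
        by (intro always_eventually allI D_le)
    qed
  qed
  then show "AE \<omega> in M. (\<lambda>n. norm (\<Sum>k<n. X k \<omega>) / (\<psi> (real n) * real n powr (1 / p))) \<longlonglongrightarrow> 0"
    unfolding D_def .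
qed

end

section \<open>Dunford--Schwartz operators and measure preserving maps\<close>

text \<open>A convergent series in \<open>ennreal\<close> has finite terms, so all moments are
  finite and \<open>moment_quasi_mono\<close> applies to their real roots \<open>a n\<close>; this
  opens the way to the dyadic series.\<close>

lemma (in block_contraction) Lp_norm_summable_imp:
  fixes \<psi> :: "real \<Rightarrow> real" and C :: real
  assumes pos: "\<And>x. x \<ge> 1 \<Longrightarrow> \<psi> x > 0" and mono: "mono_on {1..} \<psi>"
    and C: "C > 1" and dbl: "\<And>x. x \<ge> 1 \<Longrightarrow> \<psi> (2 * x) \<le> C * \<psi> x"
    and sm: "(\<Sum>n. Lp_norm M p (\<lambda>\<omega>. \<Sum>k<Suc n. X k \<omega>) /
      ennreal (\<psi> (real (Suc n)) * real (Suc n) powr (1 + 1 / p))) < \<infinity>"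
  shows "(\<lambda>\<omega>. SUP n\<in>{1..}. ennreal (norm (\<Sum>k<n. X k \<omega>) / (\<psi> (real n) * real n powr (1 / p)))) \<in> weak_Lp M p"
    and "AE \<omega> in M. (\<lambda>n. norm (\<Sum>k<n. X k \<omega>) / (\<psi> (real n) * real n powr (1 / p))) \<longlonglongrightarrow> 0"
proof -
  define a where "a n = enn2real (moment n) powr (1 / p)" for n
  define w where "w n = \<psi> (real (Suc n)) * real (Suc n) powr (1 + 1 / p)" for n
  have w: "0 < w n" for n unfolding w_def using pos[of "real (Suc n)"] by simp
  have block0: "block 0 n \<omega> = (\<Sum>k<n. X k \<omega>)" for n \<omega> by (simp add: block_def lessThan_atLeast0)
  have Lp: "Lp_norm M p (\<lambda>\<omega>. \<Sum>k<n. X k \<omega>) = (if moment n = \<infinity> then \<infinity> else ennreal (a n))" for n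
    by (simp add: Lp_norm_def moment_def Let_def block0 a_def)
  have fin_Suc: "moment (Suc n) \<noteq> \<infinity>" for n
  proof
    assume "moment (Suc n) = \<infinity>"
    then have "Lp_norm M p (\<lambda>\<omega>. \<Sum>k<Suc n. X k \<omega>) / ennreal (w n) = \<infinity>"
      unfolding Lp by (simp add: ennreal_top_divide)
    moreover have "Lp_norm M p (\<lambda>\<omega>. \<Sum>k<Suc n. X k \<omega>) / ennreal (w n) \<le>
        (\<Sum>n. Lp_norm M p (\<lambda>\<omega>. \<Sum>k<Suc n. X k \<omega>) / ennreal (w n))"
      using sum_le_suminf[of "\<lambda>n. Lp_norm M p (\<lambda>\<omega>. \<Sum>k<Suc n. X k \<omega>) / ennreal (w n)" "{n}"] by simp
    ultimately show False using sm unfolding w_def[symmetric] by (simp add: top_unique)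
  qed
  \<comment> \<open>The series starts at index \<open>1\<close>; the empty sum settles index
    \<open>0\<close>.\<close>
  have "moment 0 = 0" by (simp add: moment_def block_def)
  then have fin: "moment n < \<infinity>" for n using fin_Suc by (cases n) (auto simp: less_top)
  have "(\<Sum>n. ennreal (a (Suc n) / w n)) = (\<Sum>n. Lp_norm M p (\<lambda>\<omega>. \<Sum>k<Suc n. X k \<omega>) / ennreal (w n))"
    unfolding Lp using fin_Suc w by (intro suminf_cong) (simp add: divide_ennreal a_def)
  also have "\<dots> < \<infinity>" using sm unfolding w_def .
  finally have sm': "summable (\<lambda>n. a (Suc n) / w n)"
    using w by (intro summable_suminf_not_top) (auto simp: a_def less_imp_le intro!: divide_nonneg_nonneg)
  obtain \<kappa> where \<kappa>: "0 \<le> \<kappa>" "\<And>n N. a N \<le> \<kappa> * (a (n + N) + a n)"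
    using moment_quasi_mono fin unfolding a_def by metis
  have "summable (\<lambda>j. a (2 ^ j) / (\<psi> (2 ^ j) * (2 ^ j) powr (1 / p)))"
    using sm' unfolding w_def
    by (rule summable_dyadic_subsequence[OF _ \<kappa>(1) \<kappa>(2) p pos mono C dbl, rotated -1]) (simp_all add: a_def)
  moreover have "moment (2 ^ j) \<le> ennreal (a (2 ^ j) powr p)" for j
    using p fin[of "2 ^ j"] by (simp add: a_def powr_powr)
  moreover have "0 \<le> a (2 ^ j)" for j by (simp add: a_def)
  ultimately show "(\<lambda>\<omega>. SUP n\<in>{1..}. ennreal (norm (\<Sum>k<n. X k \<omega>) / (\<psi> (real n) * real n powr (1 / p)))) \<in> weak_Lp M p"
    and "AE \<omega> in M. (\<lambda>n. norm (\<Sum>k<n. X k \<omega>) / (\<psi> (real n) * real n powr (1 / p))) \<longlonglongrightarrow> 0"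
    using maximal_and_convergence[of \<psi> "\<lambda>j. a (2 ^ j)", OF pos mono] by auto
qed

section \<open>Truncation for Dunford--Schwartz operators\<close>

lemma dunford_schwartzD:
  assumes T: "dunford_schwartz M T" and f: "integrable M f"
  shows dunford_schwartz_integrable: "integrable M (T f)"
    and dunford_schwartz_mult: "AE \<omega> in M. T (\<lambda>x. c * f x) \<omega> = c * T f \<omega>"
    and dunford_schwartz_L1: "(LINT \<omega>|M. norm (T f \<omega>)) \<le> (LINT \<omega>|M. norm (f \<omega>))"
    and dunford_schwartz_Linfty:
      "esssup M (\<lambda>\<omega>. ennreal (norm (T f \<omega>))) \<le> esssup M (\<lambda>\<omega>. ennreal (norm (f \<omega>)))"
    and dunford_schwartz_add: "integrable M g \<Longrightarrow> AE \<omega> in M. T (\<lambda>x. f x + g x) \<omega> = T f \<omega> + T g \<omega>"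
proof -
  note D = T[unfolded dunford_schwartz_def]
  show "integrable M (T f)" by (rule D[THEN conjunct1, rule_format, OF f])
  show "AE \<omega> in M. T (\<lambda>x. f x + g x) \<omega> = T f \<omega> + T g \<omega>" if "integrable M g"
    by (rule D[THEN conjunct2, THEN conjunct2, THEN conjunct1, rule_format, OF f that])
  show "AE \<omega> in M. T (\<lambda>x. c * f x) \<omega> = c * T f \<omega>"
    by (rule D[THEN conjunct2, THEN conjunct2, THEN conjunct2, THEN conjunct1, rule_format, OF f])
  show "(LINT \<omega>|M. norm (T f \<omega>)) \<le> (LINT \<omega>|M. norm (f \<omega>))"
    by (rule D[THEN conjunct2, THEN conjunct2, THEN conjunct2, THEN conjunct2, THEN conjunct1, rule_format, OF f])
  show "esssup M (\<lambda>\<omega>. ennreal (norm (T f \<omega>))) \<le> esssup M (\<lambda>\<omega>. ennreal (norm (f \<omega>)))"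
    by (rule D[THEN conjunct2, THEN conjunct2, THEN conjunct2, THEN conjunct2, THEN conjunct2, rule_format, OF f])
qed

text \<open>Split \<open>f\<close> into a part \<open>g\<close> bounded by \<open>c\<close> and a
  part \<open>h\<close> whose norm is the excess. The sup-norm contraction keeps \<open>T g\<close>
  below \<open>c\<close>, so the excess of \<open>T f\<close> is at most the norm of
  \<open>T h\<close>, and the contraction of the integral norm finishes.\<close>

lemma dunford_schwartz_excess_le:
  fixes T :: "('a \<Rightarrow> 'k) \<Rightarrow> ('a \<Rightarrow> 'k::{real_normed_field, banach, second_countable_topology})"
  assumes T: "dunford_schwartz M T" and f: "integrable M f" and c: "0 < c"
  shows "(\<integral>\<^sup>+ \<omega>. ennreal (norm (T f \<omega>) - c) \<partial>M) \<le> (\<integral>\<^sup>+ \<omega>. ennreal (norm (f \<omega>) - c) \<partial>M)"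
proof -
  have [measurable]: "f \<in> borel_measurable M" using f by simp
  \<comment> \<open>Radial truncation also serves complex scalars; at zeros of \<open>f\<close> the
    quotient is \<open>0\<close> by convention and both parts vanish.\<close>
  define g h where "g \<omega> = min 1 (c / norm (f \<omega>)) *\<^sub>R f \<omega>"
    and "h \<omega> = (1 - min 1 (c / norm (f \<omega>))) *\<^sub>R f \<omega>" for \<omega>
  have [measurable]: "g \<in> borel_measurable M" "h \<in> borel_measurable M"
    unfolding g_def [abs_def] h_def [abs_def] by measurable
  have fgh: "f = (\<lambda>\<omega>. g \<omega> + h \<omega>)" by (simp add: g_def h_def scaleR_left_distrib[symmetric])
  have norm_g: "norm (g \<omega>) = min (norm (f \<omega>)) c" for \<omega>
    using c by (auto simp: g_def min_def field_simps)
  have norm_h: "norm (h \<omega>) = max 0 (norm (f \<omega>) - c)" for \<omega>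
  proof -
    have "norm (h \<omega>) = (1 - min 1 (c / norm (f \<omega>))) * norm (f \<omega>)" by (simp add: h_def)
    also have "\<dots> = max 0 (norm (f \<omega>) - c)"
    proof (cases "c \<le> norm (f \<omega>)")
      case True
      then have "0 < norm (f \<omega>)" using c by linarith
      then show ?thesis using True by (simp add: min_def field_simps)
    next
      case False
      then show ?thesis using c by (cases "f \<omega> = 0") (simp_all add: min_def field_simps)
    qed
    finally show ?thesis .
  qed
  have g: "integrable M g" by (rule Bochner_Integration.integrable_bound[OF f]) (auto simp: norm_g)
  have h: "integrable M h" by (rule Bochner_Integration.integrable_bound[OF f]) (use c in \<open>auto simp: norm_h\<close>)
  have Th: "integrable M (T h)" by (rule dunford_schwartz_integrable[OF T h])
  have "AE \<omega> in M. T (\<lambda>\<omega>. g \<omega> + h \<omega>) \<omega> = T g \<omega> + T h \<omega>"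
    by (rule dunford_schwartz_add[OF T g h])
  then have add: "AE \<omega> in M. T f \<omega> = T g \<omega> + T h \<omega>" by (simp only: fgh[symmetric])
  have "esssup M (\<lambda>\<omega>. ennreal (norm (T g \<omega>))) \<le> esssup M (\<lambda>\<omega>. ennreal (norm (g \<omega>)))"
    by (rule dunford_schwartz_Linfty[OF T g])
  also have "\<dots> \<le> ennreal c" by (intro esssup_I) (auto simp: norm_g intro!: AE_I2 ennreal_leI)
  finally have ess: "esssup M (\<lambda>\<omega>. ennreal (norm (T g \<omega>))) \<le> ennreal c" .
  have Tg: "AE \<omega> in M. norm (T g \<omega>) \<le> c"
    using esssup_AE[of "\<lambda>\<omega>. ennreal (norm (T g \<omega>))" M]
  proof eventually_elim
    case (elim \<omega>)
    then have "ennreal (norm (T g \<omega>)) \<le> ennreal c" using ess by (rule order_trans)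
    then show ?case using c by simp
  qed
  have "(\<integral>\<^sup>+ \<omega>. ennreal (norm (T f \<omega>) - c) \<partial>M) \<le> (\<integral>\<^sup>+ \<omega>. ennreal (norm (T h \<omega>)) \<partial>M)"
  proof (rule nn_integral_mono_AE)
    show "AE \<omega> in M. ennreal (norm (T f \<omega>) - c) \<le> ennreal (norm (T h \<omega>))"
      using add Tg
    proof eventually_elim
      case (elim \<omega>)
      have "norm (T f \<omega>) \<le> norm (T g \<omega>) + norm (T h \<omega>)"
        unfolding elim(1) by (rule norm_triangle_ineq)
      then show ?case using elim(2) by (intro ennreal_leI) linarith
    qed
  qed
  also have "\<dots> = ennreal (LINT \<omega>|M. norm (T h \<omega>))" by (rule nn_integral_eq_integral) (use Th in auto)
  also have "\<dots> \<le> ennreal (LINT \<omega>|M. norm (h \<omega>))"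
    by (intro ennreal_leI dunford_schwartz_L1[OF T h])
  also have "\<dots> = (\<integral>\<^sup>+ \<omega>. ennreal (norm (h \<omega>)) \<partial>M)" by (rule nn_integral_eq_integral[symmetric]) (use h in auto)
  also have "\<dots> = (\<integral>\<^sup>+ \<omega>. ennreal (norm (f \<omega>) - c) \<partial>M)" by (simp add: norm_h ennreal_max_0)
  finally show ?thesis .
qed

lemma dunford_schwartz_funpow_integrable:
  assumes "dunford_schwartz M T" "integrable M f"
  shows "integrable M ((T ^^ k) f)"
proof (induction k)
  case (Suc k)
  then show ?case using dunford_schwartz_integrable[OF assms(1)] by simp
qed (use assms in simp)

lemma dunford_schwartz_sum_funpow:
  fixes T :: "('a \<Rightarrow> 'k) \<Rightarrow> ('a \<Rightarrow> 'k::{real_normed_field, banach, second_countable_topology})"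
  assumes T: "dunford_schwartz M T" and f: "integrable M f" and "finite A"
  shows "AE \<omega> in M. T (\<lambda>x. \<Sum>k\<in>A. (T ^^ k) f x) \<omega> = (\<Sum>k\<in>A. (T ^^ Suc k) f \<omega>)"
  using \<open>finite A\<close>
proof (induction A)
  case empty
  \<comment> \<open>That \<open>T\<close> annihilates \<open>0\<close> follows from homogeneity with
    the scalar \<open>0\<close>.\<close>
  have "AE \<omega> in M. T (\<lambda>x. 0 * (0 :: 'k)) \<omega> = 0 * T (\<lambda>_. 0) \<omega>"
    by (rule dunford_schwartz_mult[OF T]) simp
  then show ?case by simp
next
  case (insert j A)
  have "integrable M (\<lambda>x. \<Sum>k\<in>A. (T ^^ k) f x)"
    by (intro Bochner_Integration.integrable_sum dunford_schwartz_funpow_integrable[OF T f])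
  then have "AE \<omega> in M. T (\<lambda>x. (T ^^ j) f x + (\<Sum>k\<in>A. (T ^^ k) f x)) \<omega>
      = T ((T ^^ j) f) \<omega> + T (\<lambda>x. \<Sum>k\<in>A. (T ^^ k) f x) \<omega>"
    by (rule dunford_schwartz_add[OF T dunford_schwartz_funpow_integrable[OF T f]])
  with insert.IH show ?case
    by eventually_elim (simp add: insert.hyps)
qed

text \<open>Brings \<open>f\<close> into the domain on which the laws of \<open>T\<close> are
  postulated; the constant \<open>1\<close> in the pointwise bound is integrable as the measure is
  finite.\<close>

lemma (in prob_space) Lp_space_imp_integrable:
  fixes f :: "'a \<Rightarrow> 'b::{banach, second_countable_topology}"
  assumes f: "f \<in> Lp_space M p" and p: "1 \<le> p"
  shows "integrable M f"
proof -
  have [measurable]: "f \<in> borel_measurable M"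
    using f by (simp add: Lp_space_def bochner_measurable_iff_borel)
  have fin: "(\<integral>\<^sup>+ \<omega>. ennreal (norm (f \<omega>) powr p) \<partial>M) < \<infinity>"
    using f by (auto simp: Lp_space_def Lp_norm_def Let_def less_top split: if_splits)
  have "norm (f \<omega>) \<le> 1 + norm (f \<omega>) powr p" for \<omega>
  proof (cases "norm (f \<omega>) \<le> 1")
    case False
    then have "norm (f \<omega>) powr 1 \<le> norm (f \<omega>) powr p" using p by (intro powr_mono) auto
    then show ?thesis using False by simp
  qed (simp add: add_increasing2)
  then have "(\<integral>\<^sup>+ \<omega>. ennreal (norm (f \<omega>)) \<partial>M) \<le> (\<integral>\<^sup>+ \<omega>. 1 + ennreal (norm (f \<omega>) powr p) \<partial>M)"
    by (intro nn_integral_mono) (metis ennreal_1 ennreal_leI ennreal_plus powr_ge_zero zero_le_one)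
  also have "\<dots> = 1 + (\<integral>\<^sup>+ \<omega>. ennreal (norm (f \<omega>) powr p) \<partial>M)"
    by (subst nn_integral_add) (auto simp: emeasure_space_1)
  also have "\<dots> < \<infinity>" using fin by simp
  finally show ?thesis by (simp add: integrable_iff_bounded)
qed

text \<open>Up to a null set \<open>T\<close> shifts a block by one place, so the truncation
  inequality becomes \<open>block_tail\<close>.\<close>

lemma block_contraction_dunford_schwartz:
  fixes T :: "('a \<Rightarrow> 'k) \<Rightarrow> ('a \<Rightarrow> 'k::{real_normed_field, banach, second_countable_topology})"
  assumes M: "prob_space M" and T: "dunford_schwartz M T" and f: "integrable M f" and p: "1 < p"
  shows "block_contraction M (\<lambda>k. (T ^^ k) f) p"
proof -
  interpret prob_space M by fact
  have int: "integrable M (\<lambda>\<omega>. \<Sum>k\<in>A. (T ^^ k) f \<omega>)" for A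
    by (intro Bochner_Integration.integrable_sum dunford_schwartz_funpow_integrable[OF T f])
  show ?thesis
  proof
    fix c :: real and i n :: nat assume c: "0 < c"
    have "(\<integral>\<^sup>+ \<omega>. ennreal (norm (\<Sum>k\<in>{Suc i..<Suc i + n}. (T ^^ k) f \<omega>) - c) \<partial>M) =
        (\<integral>\<^sup>+ \<omega>. ennreal (norm (T (\<lambda>x. \<Sum>k\<in>{i..<i + n}. (T ^^ k) f x) \<omega>) - c) \<partial>M)"
    proof (rule nn_integral_cong_AE)
      show "AE \<omega> in M. ennreal (norm (\<Sum>k\<in>{Suc i..<Suc i + n}. (T ^^ k) f \<omega>) - c) =
          ennreal (norm (T (\<lambda>x. \<Sum>k\<in>{i..<i + n}. (T ^^ k) f x) \<omega>) - c)"
        using dunford_schwartz_sum_funpow[OF T f, of "{i..<i + n}", OF finite_atLeastLessThan]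
      proof eventually_elim
        case (elim \<omega>)
        have "(\<Sum>k\<in>{Suc i..<Suc i + n}. (T ^^ k) f \<omega>) = (\<Sum>k\<in>{i..<i + n}. (T ^^ Suc k) f \<omega>)"
          unfolding add_Suc by (rule sum.shift_bounds_Suc_ivl)
        then show ?case unfolding elim by simp
      qed
    qed
    also have "\<dots> \<le> (\<integral>\<^sup>+ \<omega>. ennreal (norm (\<Sum>k\<in>{i..<i + n}. (T ^^ k) f \<omega>) - c) \<partial>M)"
      by (rule dunford_schwartz_excess_le[OF T int c])
    finally show "(\<integral>\<^sup>+ \<omega>. ennreal (norm (\<Sum>k\<in>{Suc i..<Suc i + n}. (T ^^ k) f \<omega>) - c) \<partial>M) \<le>
        (\<integral>\<^sup>+ \<omega>. ennreal (norm (\<Sum>k\<in>{i..<i + n}. (T ^^ k) f \<omega>) - c) \<partial>M)" .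
  next
    show "(\<lambda>\<omega>. norm (\<Sum>k\<in>{i..<i + n}. (T ^^ k) f \<omega>)) \<in> borel_measurable M" for i n
      by (rule borel_measurable_integrable[OF integrable_norm[OF int]])
  qed (fact p)
qed

section \<open>Bochner measurable functions along a measure preserving map\<close>

lemma bochner_measurable_comp:
  assumes "\<theta> \<in> measurable M N" "bochner_measurable N f"
  shows "bochner_measurable M (f \<circ> \<theta>)"
proof -
  obtain s where "\<And>i. simple_function N (s i)" "\<And>\<omega>. \<omega> \<in> space N \<Longrightarrow> (\<lambda>i. s i \<omega>) \<longlonglongrightarrow> f \<omega>"
    using assms(2) unfolding bochner_measurable_def by blast
  with assms(1) show ?thesis
    unfolding bochner_measurable_def
    by (intro exI[of _ "\<lambda>i x. s i (\<theta> x)"]) (auto intro: simple_function_comp dest: measurable_space)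
qed

lemma bochner_measurable_add:
  assumes "bochner_measurable M f" "bochner_measurable M g"
  shows "bochner_measurable M (\<lambda>\<omega>. f \<omega> + g \<omega>)"
proof -
  obtain s t where "\<And>i. simple_function M (s i)" "\<And>\<omega>. \<omega> \<in> space M \<Longrightarrow> (\<lambda>i. s i \<omega>) \<longlonglongrightarrow> f \<omega>"
    and "\<And>i. simple_function M (t i)" "\<And>\<omega>. \<omega> \<in> space M \<Longrightarrow> (\<lambda>i. t i \<omega>) \<longlonglongrightarrow> g \<omega>"
    using assms unfolding bochner_measurable_def by blast
  then show ?thesis
    unfolding bochner_measurable_def
    by (intro exI[of _ "\<lambda>i x. s i x + t i x"]) (auto intro: simple_function_compose2 tendsto_add)
qed

lemma bochner_measurable_sum:
  assumes "finite A" "\<And>k. k \<in> A \<Longrightarrow> bochner_measurable M (f k)"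
  shows "bochner_measurable M (\<lambda>\<omega>. \<Sum>k\<in>A. f k \<omega>)"
  using assms
proof (induction A)
  case empty
  show ?case unfolding bochner_measurable_def by (intro exI[of _ "\<lambda>_ _. 0"]) simp
qed (simp add: bochner_measurable_add)

lemma bochner_measurable_norm:
  assumes "bochner_measurable M f"
  shows "(\<lambda>\<omega>. norm (f \<omega>)) \<in> borel_measurable M"
proof -
  obtain s where s: "\<And>i. simple_function M (s i)" and lim: "\<And>\<omega>. \<omega> \<in> space M \<Longrightarrow> (\<lambda>i. s i \<omega>) \<longlonglongrightarrow> f \<omega>"
    using assms unfolding bochner_measurable_def by blast
  have "(\<lambda>\<omega>. norm (s i \<omega>)) \<in> borel_measurable M" for i
    by (rule borel_measurable_simple_function[OF simple_function_compose1[OF s]])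
  then show ?thesis by (rule borel_measurable_LIMSEQ_real[rotated]) (rule tendsto_norm[OF lim])
qed

text \<open>A shifted block is the original block composed with \<open>\<theta>\<close>. Its norm
  has the same distribution, so \<open>block_tail\<close> holds with equality, and only real
  functions are integrated.\<close>

lemma block_contraction_measure_preserving:
  fixes f :: "'a \<Rightarrow> 'b::banach"
  assumes M: "prob_space M" and \<theta>: "measure_preserving_map M \<theta>" and f: "bochner_measurable M f" and p: "1 < p"
  shows "block_contraction M (\<lambda>k. ((\<lambda>g. g \<circ> \<theta>) ^^ k) f) p"
proof -
  interpret prob_space M by fact
  have \<theta>m [measurable]: "\<theta> \<in> measurable M M" and distr: "distr M M \<theta> = M"
    using \<theta> by (auto simp: measure_preserving_map_def)
  have "bochner_measurable M (((\<lambda>g. g \<circ> \<theta>) ^^ k) f)" for k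
  proof (induction k)
    case (Suc k)
    have "((\<lambda>g. g \<circ> \<theta>) ^^ Suc k) f = ((\<lambda>g. g \<circ> \<theta>) ^^ k) f \<circ> \<theta>" by simp
    then show ?case using bochner_measurable_comp[OF \<theta>m Suc] by (simp only:)
  qed (simp add: f)
  then have meas [measurable]: "(\<lambda>\<omega>. norm (\<Sum>k\<in>A. ((\<lambda>g. g \<circ> \<theta>) ^^ k) f \<omega>)) \<in> borel_measurable M" if "finite A" for A
    using that by (intro bochner_measurable_norm bochner_measurable_sum)
  show ?thesis
  proof
    fix c :: real and i n :: nat assume c: "0 < c"
    let ?B = "\<lambda>\<omega>. ennreal (norm (\<Sum>k\<in>{i..<i + n}. ((\<lambda>g. g \<circ> \<theta>) ^^ k) f \<omega>) - c)"
    have "(\<Sum>k\<in>{Suc i..<Suc i + n}. ((\<lambda>g. g \<circ> \<theta>) ^^ k) f \<omega>) = (\<Sum>k\<in>{i..<i + n}. ((\<lambda>g. g \<circ> \<theta>) ^^ k) f (\<theta> \<omega>))" for \<omega>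
      unfolding add_Suc sum.shift_bounds_Suc_ivl by simp
    then have "(\<integral>\<^sup>+ \<omega>. ennreal (norm (\<Sum>k\<in>{Suc i..<Suc i + n}. ((\<lambda>g. g \<circ> \<theta>) ^^ k) f \<omega>) - c) \<partial>M) = (\<integral>\<^sup>+ \<omega>. ?B (\<theta> \<omega>) \<partial>M)"
      by simp
    also have "\<dots> = (\<integral>\<^sup>+ \<omega>. ?B \<omega> \<partial>distr M M \<theta>)" by (rule nn_integral_distr[symmetric]) measurable
    also have "\<dots> = (\<integral>\<^sup>+ \<omega>. ?B \<omega> \<partial>M)" unfolding distr ..
    finally show "(\<integral>\<^sup>+ \<omega>. ennreal (norm (\<Sum>k\<in>{Suc i..<Suc i + n}. ((\<lambda>g. g \<circ> \<theta>) ^^ k) f \<omega>) - c) \<partial>M) \<le> (\<integral>\<^sup>+ \<omega>. ?B \<omega> \<partial>M)"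
      by simp
  next
    show "(\<lambda>\<omega>. norm (\<Sum>k\<in>{i..<i + n}. ((\<lambda>g. g \<circ> \<theta>) ^^ k) f \<omega>)) \<in> borel_measurable M" for i n
      by (rule meas) simp
  qed (fact p)
qed

text \<open>Both cases are instances of \<open>block_contraction\<close>, with iterates of
  \<open>T\<close> or of composition with \<open>\<theta>\<close>;
  \<open>Lp_norm_summable_imp\<close> then yields each pair of conclusions.\<close>

theorem theorem4p7:
  fixes M :: "'a measure"
    and T :: "('a \<Rightarrow> 'k) \<Rightarrow> ('a \<Rightarrow> 'k::{real_normed_field, banach, second_countable_topology})"
    and p C :: real
    and \<psi> :: "real \<Rightarrow> real"
  assumes "prob_space M"
    and "dunford_schwartz M T"
    and "p > 1"
    and "\<And>x. x \<ge> 1 \<Longrightarrow> \<psi> x > 0"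
    and "mono_on {1..} \<psi>"
    and "C > 1"
    and "\<And>x. x \<ge> 1 \<Longrightarrow> \<psi> (2 * x) \<le> C * \<psi> x"
  shows
    "(\<forall>f \<in> Lp_space M p.
        (\<Sum>n. Lp_norm M p (ergodic_sum T f (Suc n)) /
              ennreal (\<psi> (real (Suc n)) * real (Suc n) powr (1 + 1 / p))) < \<infinity> \<longrightarrow>
        (\<lambda>\<omega>. SUP n\<in>{1..}. ennreal (norm (ergodic_sum T f n \<omega>) / (\<psi> (real n) * real n powr (1 / p))))
          \<in> weak_Lp M p \<and>
        (AE \<omega> in M. (\<lambda>n. norm (ergodic_sum T f n \<omega>) / (\<psi> (real n) * real n powr (1 / p)))
          \<longlonglongrightarrow> 0)) \<and>
     (\<forall>\<theta>. induced_by M T \<theta> \<longrightarrow>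
       (\<forall>f :: 'a \<Rightarrow> 'b::banach. f \<in> Lp_space M p \<longrightarrow>
        (\<Sum>n. Lp_norm M p (ergodic_sum (\<lambda>g. g \<circ> \<theta>) f (Suc n)) /
              ennreal (\<psi> (real (Suc n)) * real (Suc n) powr (1 + 1 / p))) < \<infinity> \<longrightarrow>
        (\<lambda>\<omega>. SUP n\<in>{1..}. ennreal (norm (ergodic_sum (\<lambda>g. g \<circ> \<theta>) f n \<omega>) /
              (\<psi> (real n) * real n powr (1 / p))))
          \<in> weak_Lp M p \<and>
        (AE \<omega> in M. (\<lambda>n. norm (ergodic_sum (\<lambda>g. g \<circ> \<theta>) f n \<omega>) /
              (\<psi> (real n) * real n powr (1 / p)))
          \<longlonglongrightarrow> 0)))"
proof (intro conjI ballI allI impI)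
  fix f :: "'a \<Rightarrow> 'k"
  assume f: "f \<in> Lp_space M p"
    and sm: "(\<Sum>n. Lp_norm M p (ergodic_sum T f (Suc n)) /
      ennreal (\<psi> (real (Suc n)) * real (Suc n) powr (1 + 1 / p))) < \<infinity>"
  have "integrable M f"
    using prob_space.Lp_space_imp_integrable[OF assms(1) f] assms(3) by simp
  then interpret block_contraction M "\<lambda>k. (T ^^ k) f" p
    using assms(1-3) by (intro block_contraction_dunford_schwartz)
  note * = Lp_norm_summable_imp[OF assms(4-7) sm[unfolded ergodic_sum_def [abs_def]]]
  show "(\<lambda>\<omega>. SUP n\<in>{1..}. ennreal (norm (ergodic_sum T f n \<omega>) / (\<psi> (real n) * real n powr (1 / p)))) \<in> weak_Lp M p"
    unfolding ergodic_sum_def by (rule *(1))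
  show "AE \<omega> in M. (\<lambda>n. norm (ergodic_sum T f n \<omega>) / (\<psi> (real n) * real n powr (1 / p))) \<longlonglongrightarrow> 0"
    unfolding ergodic_sum_def by (rule *(2))
next
  fix \<theta> and f :: "'a \<Rightarrow> 'b"
  assume \<theta>: "induced_by M T \<theta>" and f: "f \<in> Lp_space M p"
    and sm: "(\<Sum>n. Lp_norm M p (ergodic_sum (\<lambda>g. g \<circ> \<theta>) f (Suc n)) /
      ennreal (\<psi> (real (Suc n)) * real (Suc n) powr (1 + 1 / p))) < \<infinity>"
  interpret block_contraction M "\<lambda>k. ((\<lambda>g. g \<circ> \<theta>) ^^ k) f" p
    using \<theta> f assms(1,3) by (intro block_contraction_measure_preserving) (auto simp: induced_by_def Lp_space_def)
  note * = Lp_norm_summable_imp[OF assms(4-7) sm[unfolded ergodic_sum_def [abs_def]]]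
  show "(\<lambda>\<omega>. SUP n\<in>{1..}. ennreal (norm (ergodic_sum (\<lambda>g. g \<circ> \<theta>) f n \<omega>) / (\<psi> (real n) * real n powr (1 / p)))) \<in> weak_Lp M p"
    unfolding ergodic_sum_def by (rule *(1))
  show "AE \<omega> in M. (\<lambda>n. norm (ergodic_sum (\<lambda>g. g \<circ> \<theta>) f n \<omega>) / (\<psi> (real n) * real n powr (1 / p))) \<longlonglongrightarrow> 0"
    unfolding ergodic_sum_def by (rule *(2))
qed

end
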